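(* Let $A$ be a self-adjoint operator in a Hilbert space $H$ with $A\ge 0$. For $\lambda\in\mathbb{R}$ let $$F(A,\lambda)=\{x : x\in D(A^n),\ \|A^nx\|\le\lambda^n\|x\|\ \text{ for all } n\in\mathbb{N}\}$$ and let $E(\lambda)=P_{F(A,\lambda)}$ be the orthogonal projection of $H$ onto the closed linear subspace $F(A,\lambda)$. Then $(E(\lambda))_{\lambda\in\mathbb{R}}$ is the spectral family of $A$; that is, it is a spectral family and $$A=\int_{\mathbb{R}}\lambda\,dE(\lambda).$$
   Context: Hilbert spaces may be real or complex; $\mathbb{N}=\{1,2,\dots\}$. $A\ge0$ means $\langle Ax,x\rangle\ge0$ for all $x\in D(A)$. A spectral family in $H$ is a family $(E(\lambda))_{\lambda\in\mathbb{R}}$ of orthogonal projections in $H$ such that $E(\lambda)\le E(\mu)$ for $\lambda\le\mu$; $\lambda\mapsto E(\lambda)x$ is right-continuous for every $x\in H$; and for every $x\in H$, $E(\lambda)x\to 0$ as $\lambda\to-\infty$ and $E(\lambda)x\to x$ as $\lambda\to\infty$. For a self-adjoint operator $A$ with domain $D(A)$, the notation $A=\int_{\mathbb{R}}\lambda\,dE(\lambda)$ means: $D(A)=\{x\in H : \int_{\mathbb{R}}\lambda^2\,d\langle E(\lambda)x,x\rangle<\infty\}$, and for all $x\in D(A)$ one has $\langle Ax,x\rangle=\int_{\mathbb{R}}\lambda\,d\langle E(\lambda)x,x\rangle$ and $\|Ax\|^2=\int_{\mathbb{R}}\lambda^2\,d\langle E(\lambda)x,x\rangle$ (Lebesgue-Stieltjes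 integrals). *)

theory Defs
  imports "HOL-Analysis.Analysis"
begin

text \<open>
  Scalars. The axioms leave exactly the two models \<open>\<real>\<close> and \<open>\<complex>\<close>: since
  \<open>z * rc_cnj z\<close> and \<open>z + rc_cnj z\<close> are real, every scalar is a root of a real quadratic
  polynomial, and \<open>rc_cnj z = norm z ^ 2 / z\<close> is forced.
\<close>

class rc_field = real_normed_field +
  fixes rc_cnj :: "'a \<Rightarrow> 'a"
    and rc_Re :: "'a \<Rightarrow> real"
  assumes rc_cnj_add: "rc_cnj (x + y) = rc_cnj x + rc_cnj y"
    and rc_cnj_mult: "rc_cnj (x * y) = rc_cnj x * rc_cnj y"
    and mult_rc_cnj: "x * rc_cnj x = (norm x)\<^sup>2 *\<^sub>R 1"
    and add_rc_cnj: "x + rc_cnj x = (2 * rc_Re x) *\<^sub>R 1"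

instantiation real :: rc_field
begin
definition rc_cnj_real :: "real \<Rightarrow> real" where "rc_cnj_real x = x"
definition rc_Re_real :: "real \<Rightarrow> real" where "rc_Re_real x = x"
instance
  by standard (simp_all add: rc_cnj_real_def rc_Re_real_def power2_eq_square)
end

instantiation complex :: rc_field
begin
definition rc_cnj_complex :: "complex \<Rightarrow> complex" where "rc_cnj_complex = cnj"
definition rc_Re_complex :: "complex \<Rightarrow> real" where "rc_Re_complex = Re"
instance
  by standard
    (simp_all add: rc_cnj_complex_def rc_Re_complex_def complex_norm_square complex_add_cnj scaleR_conv_of_real
      del: of_real_power)
end

text \<open>
  A Hilbert space over \<open>\<real>\<close> or \<open>\<complex>\<close>. The type \<open>'a\<close> carries the norm, the metric and the
  underlying real Hilbert space; \<open>smul\<close> and \<open>ip\<close> are the scalar multiplication and the inner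
  product of the space over its own scalar field. By polarization the last axiom says that the
  real part of \<open>ip\<close> is the real inner product of \<open>'a\<close>; every complex Hilbert space arises in
  this way.
\<close>

locale rc_hilbert_space = vector_space smul
  for smul :: "'k::rc_field \<Rightarrow> 'a::{real_inner,complete_space} \<Rightarrow> 'a" +
  fixes ip :: "'a \<Rightarrow> 'a \<Rightarrow> 'k"
  assumes smul_of_real: "smul (of_real r) x = r *\<^sub>R x"
    and ip_add_left: "ip (x + y) z = ip x z + ip y z"
    and ip_smul_left: "ip (smul c x) z = c * ip x z"
    and ip_commute: "ip y x = rc_cnj (ip x y)"
    and ip_self: "ip x x = of_real ((norm x)\<^sup>2)"

lemma rc_hilbert_space_real:
  "rc_hilbert_space (scaleR :: real \<Rightarrow> 'a::{real_inner,complete_space} \<Rightarrow> 'a) inner"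
  by unfold_locales
    (simp_all add: algebra_simps inner_commute power2_norm_eq_inner rc_cnj_real_def)

lemma rc_hilbert_space_complex:
  "rc_hilbert_space ((*) :: complex \<Rightarrow> complex \<Rightarrow> complex) (\<lambda>x y. x * cnj y)"
  by unfold_locales
    (simp_all add: algebra_simps rc_cnj_complex_def scaleR_conv_of_real complex_norm_square
      del: of_real_power)

text \<open>
  An unbounded operator is given by its domain \<open>D\<close> and a function \<open>A\<close>, whose values outside
  \<open>D\<close> are irrelevant.
\<close>

definition linear_operator_on ::
  "('k::rc_field \<Rightarrow> 'a::real_normed_vector \<Rightarrow> 'a) \<Rightarrow> 'a set \<Rightarrow> ('a \<Rightarrow> 'a) \<Rightarrow> bool" where
  "linear_operator_on smul D A \<longleftrightarrow>
     module.subspace smul D \<and>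
     (\<forall>x\<in>D. \<forall>y\<in>D. A (x + y) = A x + A y) \<and>
     (\<forall>c. \<forall>x\<in>D. A (smul c x) = smul c (A x))"

definition adjoint_dom ::
  "('a \<Rightarrow> 'a \<Rightarrow> 'k) \<Rightarrow> 'a set \<Rightarrow> ('a \<Rightarrow> 'a) \<Rightarrow> 'a set" where
  "adjoint_dom ip D A = {y. \<exists>z. \<forall>x\<in>D. ip (A x) y = ip x z}"

definition adjoint_op ::
  "('a \<Rightarrow> 'a \<Rightarrow> 'k) \<Rightarrow> 'a set \<Rightarrow> ('a \<Rightarrow> 'a) \<Rightarrow> 'a \<Rightarrow> 'a" where
  "adjoint_op ip D A y = (THE z. \<forall>x\<in>D. ip (A x) y = ip x z)"

definition self_adjoint ::
  "('k::rc_field \<Rightarrow> 'a::real_normed_vector \<Rightarrow> 'a) \<Rightarrow> ('a \<Rightarrow> 'a \<Rightarrow> 'k)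
    \<Rightarrow> 'a set \<Rightarrow> ('a \<Rightarrow> 'a) \<Rightarrow> bool" where
  "self_adjoint smul ip D A \<longleftrightarrow>
     linear_operator_on smul D A \<and> closure D = UNIV \<and>
     adjoint_dom ip D A = D \<and> (\<forall>x\<in>D. adjoint_op ip D A x = A x)"

definition nonneg_operator ::
  "('a \<Rightarrow> 'a \<Rightarrow> 'k::rc_field) \<Rightarrow> 'a set \<Rightarrow> ('a \<Rightarrow> 'a) \<Rightarrow> bool" where
  "nonneg_operator ip D A \<longleftrightarrow> (\<forall>x\<in>D. ip (A x) x \<in> \<real>\<^sub>\<ge>\<^sub>0)"

primrec power_dom :: "'a set \<Rightarrow> ('a \<Rightarrow> 'a) \<Rightarrow> nat \<Rightarrow> 'a set" where
  "power_dom D A 0 = UNIV"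
| "power_dom D A (Suc n) = {x \<in> power_dom D A n. (A ^^ n) x \<in> D}"

definition F_space ::
  "'a::real_normed_vector set \<Rightarrow> ('a \<Rightarrow> 'a) \<Rightarrow> real \<Rightarrow> 'a set" where
  "F_space D A t =
     {x. \<forall>n\<ge>1. x \<in> power_dom D A n \<and> norm ((A ^^ n) x) \<le> t ^ n * norm x}"

definition orth_proj ::
  "('a::real_normed_vector \<Rightarrow> 'a \<Rightarrow> 'k::rc_field) \<Rightarrow> 'a set \<Rightarrow> 'a \<Rightarrow> 'a" where
  "orth_proj ip M x = (THE y. y \<in> M \<and> (\<forall>z\<in>M. ip (x - y) z = 0))"

definition closed_subspace ::
  "('k::rc_field \<Rightarrow> 'a::real_normed_vector \<Rightarrow> 'a) \<Rightarrow> 'a set \<Rightarrow> bool" where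
  "closed_subspace smul M \<longleftrightarrow> module.subspace smul M \<and> closed M"

definition is_orth_proj ::
  "('k::rc_field \<Rightarrow> 'a::real_normed_vector \<Rightarrow> 'a) \<Rightarrow> ('a \<Rightarrow> 'a \<Rightarrow> 'k) \<Rightarrow> ('a \<Rightarrow> 'a) \<Rightarrow> bool" where
  "is_orth_proj smul ip P \<longleftrightarrow> (\<exists>M. closed_subspace smul M \<and> P = orth_proj ip M)"

definition spectral_family ::
  "('k::rc_field \<Rightarrow> 'a::real_normed_vector \<Rightarrow> 'a) \<Rightarrow> ('a \<Rightarrow> 'a \<Rightarrow> 'k)
    \<Rightarrow> (real \<Rightarrow> 'a \<Rightarrow> 'a) \<Rightarrow> bool" where
  "spectral_family smul ip E \<longleftrightarrow>
     (\<forall>t. is_orth_proj smul ip (E t)) \<and>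
     (\<forall>t s. t \<le> s \<longrightarrow> nonneg_operator ip UNIV (\<lambda>x. E s x - E t x)) \<and>
     (\<forall>x t. continuous (at_right t) (\<lambda>s. E s x)) \<and>
     (\<forall>x. ((\<lambda>t. E t x) \<longlongrightarrow> 0) at_bot) \<and>
     (\<forall>x. ((\<lambda>t. E t x) \<longlongrightarrow> x) at_top)"

text \<open>
  The Lebesgue-Stieltjes measure \<open>d\<langle>E(\<lambda>)x,x\<rangle>\<close>. The function \<open>\<lambda> \<mapsto> \<langle>E(\<lambda>)x,x\<rangle>\<close> is real-valued;
  \<open>rc_Re\<close> only changes its type.
\<close>

definition spectral_measure ::
  "('a \<Rightarrow> 'a \<Rightarrow> 'k::rc_field) \<Rightarrow> (real \<Rightarrow> 'a \<Rightarrow> 'a) \<Rightarrow> 'a \<Rightarrow> real measure" where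
  "spectral_measure ip E x = interval_measure (\<lambda>t. rc_Re (ip (E t x) x))"

text \<open>
  The meaning of \<open>A = \<integral> \<lambda> dE(\<lambda>)\<close>. Integrability of \<open>\<lambda>\<close> is stated explicitly because the
  Bochner integral of a non-integrable function is \<open>0\<close> by convention.
\<close>

definition has_spectral_integral ::
  "('a::real_normed_vector \<Rightarrow> 'a \<Rightarrow> 'k::rc_field) \<Rightarrow> 'a set \<Rightarrow> ('a \<Rightarrow> 'a)
    \<Rightarrow> (real \<Rightarrow> 'a \<Rightarrow> 'a) \<Rightarrow> bool" where
  "has_spectral_integral ip D A E \<longleftrightarrow>
     D = {x. (\<integral>\<^sup>+ t. ennreal (t\<^sup>2) \<partial>spectral_measure ip E x) < \<infinity>} \<and>
     (\<forall>x\<in>D. integrable (spectral_measure ip E x) (\<lambda>t. t) \<and>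
       ip (A x) x = of_real (\<integral>t. t \<partial>spectral_measure ip E x) \<and>
       ennreal ((norm (A x))\<^sup>2) = (\<integral>\<^sup>+ t. ennreal (t\<^sup>2) \<partial>spectral_measure ip E x))"

end

theory Submission
  imports Defs
begin

text \<open>
  Self-adjointness and the spaces \<open>F(t) = F(A, t)\<close> only depend on the real part of the inner
  product. Since \<open>n \<mapsto> \<parallel>A\<^sup>n x\<parallel>\<close> is log-convex, \<open>F(t)\<close> is, for \<open>t \<ge> 0\<close>, the set of all \<open>x\<close> with
  \<open>\<parallel>A\<^sup>n x\<parallel> = O(t\<^sup>n)\<close>; it is thus the largest \<open>A\<close>-invariant subspace on which \<open>A\<close> is bounded by
  \<open>t\<close>, it is closed, and it reduces \<open>A\<close>. With the resolvent \<open>B = (1 + A)\<inverse>\<close>, the bounded operator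
  \<open>C = (1 + t) B - 1\<close> and its absolute value \<open>R\<close>, the kernel of \<open>R - C\<close> is contained in \<open>F(t)\<close>.
  Hence \<open>C \<le> 0\<close>, and so \<open>A \<ge> t\<close>, on the orthogonal complement of \<open>F(t)\<close>. For \<open>s \<le> t\<close> this gives
  \<open>s \<le> A \<le> t\<close> on the range of \<open>E(t) - E(s)\<close>, which determines \<open>\<parallel>A E(t) x\<parallel>\<^sup>2\<close> and
  \<open>\<langle>A E(t) x, E(t) x\<rangle>\<close> as Stieltjes integrals; let \<open>t \<longlongrightarrow> \<infinity>\<close>.
\<close>

subsection \<open>Orthogonal projections in a real Hilbert space\<close>

lemma parallelogram_midpoint:
  fixes x y z :: "'a::real_inner"
  shows "(norm (y - z))\<^sup>2
    = 2 * (norm (x - y))\<^sup>2 + 2 * (norm (x - z))\<^sup>2 - 4 * (norm (x - (1/2) *\<^sub>R (y + z)))\<^sup>2"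
  by (simp add: power2_norm_eq_inner inner_diff_left inner_diff_right inner_add_left inner_add_right
      inner_commute algebra_simps)

text \<open>A minimizing sequence is Cauchy: the midpoint of two of its terms lies in
  \<open>M\<close>, so its squared distance to \<open>x\<close> is at least \<open>d\<close>, and
  the parallelogram identity forces the terms together.\<close>

lemma nearest_point_exists:
  fixes M :: "'a::{real_inner,complete_space} set"
  assumes M: "subspace M" "closed M"
  shows "\<exists>y\<in>M. \<forall>z\<in>M. (norm (x - y))\<^sup>2 \<le> (norm (x - z))\<^sup>2"
proof -
  define d where "d = Inf ((\<lambda>z. (norm (x - z))\<^sup>2) ` M)"
  have ne: "M \<noteq> {}" using M(1) subspace_0 by blast
  have bdd: "bdd_below ((\<lambda>z. (norm (x - z))\<^sup>2) ` M)"
    by (rule bdd_belowI[of _ 0]) auto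
  have d_le: "d \<le> (norm (x - z))\<^sup>2" if "z \<in> M" for z
    unfolding d_def using bdd that by (intro cInf_lower) auto
  have "\<exists>y\<in>M. (norm (x - y))\<^sup>2 < d + inverse (real (Suc n))" for n
  proof -
    have "Inf ((\<lambda>z. (norm (x - z))\<^sup>2) ` M) < d + inverse (real (Suc n))"
      unfolding d_def by simp
    then show ?thesis
      using cInf_lessD[of "(\<lambda>z. (norm (x - z))\<^sup>2) ` M"] ne by auto
  qed
  then obtain Y where Y: "\<And>n. Y n \<in> M"
      and Yd: "\<And>n. (norm (x - Y n))\<^sup>2 < d + inverse (real (Suc n))"
    by metis
  have dist_bound: "(norm (Y m - Y n))\<^sup>2 \<le> 2 * inverse (real (Suc m)) + 2 * inverse (real (Suc n))" for m n
  proof -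
    have "(1/2) *\<^sub>R (Y m + Y n) \<in> M"
      using M(1) Y by (intro subspace_scale subspace_add)
    from d_le[OF this] show ?thesis
      using Yd[of m] Yd[of n] parallelogram_midpoint[of "Y m" "Y n" x] by linarith
  qed
  have "Cauchy Y"
  proof (rule CauchyI)
    fix e :: real assume "0 < e"
    then have "0 < e\<^sup>2 / 4" by simp
    then obtain N where N: "inverse (real (Suc N)) < e\<^sup>2 / 4"
      using reals_Archimedean by blast
    have "norm (Y m - Y n) < e" if "m \<ge> N" "n \<ge> N" for m n
    proof -
      have *: "inverse (real (Suc m)) \<le> inverse (real (Suc N))" "inverse (real (Suc n)) \<le> inverse (real (Suc N))"
        using that by (auto intro!: le_imp_inverse_le)
      have "(norm (Y m - Y n))\<^sup>2 < e\<^sup>2"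
        using dist_bound[of m n] N * by linarith
      with \<open>0 < e\<close> show ?thesis
        by (simp add: power_less_imp_less_base)
    qed
    then show "\<exists>N. \<forall>m\<ge>N. \<forall>n\<ge>N. norm (Y m - Y n) < e" by blast
  qed
  then obtain y where y: "Y \<longlonglongrightarrow> y"
    using Cauchy_convergent convergent_def by blast
  have "y \<in> M"
    using M(2) Y y closed_sequentially by blast
  have "(norm (x - y))\<^sup>2 \<le> d"
  proof (rule LIMSEQ_le)
    show "(\<lambda>n. (norm (x - Y n))\<^sup>2) \<longlonglongrightarrow> (norm (x - y))\<^sup>2"
      by (intro tendsto_intros y)
    show "(\<lambda>n. d + inverse (real (Suc n))) \<longlonglongrightarrow> d"
      using tendsto_add[OF tendsto_const[of d] LIMSEQ_inverse_real_of_nat] by simp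
  qed (use Yd less_imp_le in blast)
  with \<open>y \<in> M\<close> d_le show ?thesis by (meson order_trans)
qed

text \<open>Formed with the real inner product only. \<open>orth_proj_eq_proj\<close> identifies it
  with \<open>orth_proj\<close> on subspaces over the scalar field, so the analysis can be done over
  the reals.\<close>

definition proj :: "'a::real_inner set \<Rightarrow> 'a \<Rightarrow> 'a" where
  "proj M x = (THE y. y \<in> M \<and> (\<forall>z\<in>M. inner (x - y) z = 0))"

lemma proj_unique_aux:
  assumes "subspace M" "y \<in> M" "\<forall>z\<in>M. inner (x - y) z = 0" "y' \<in> M" "\<forall>z\<in>M. inner (x - y') z = 0"
  shows "y' = y"
proof -
  have "y' - y \<in> M" using assms subspace_diff by blast
  then have "inner ((x - y) - (x - y')) (y' - y) = 0"
    using assms by (simp only: inner_diff_left)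
  then show ?thesis by simp
qed

lemma proj_ex1:
  fixes M :: "'a::{real_inner,complete_space} set"
  assumes M: "subspace M" "closed M"
  shows "\<exists>!y. y \<in> M \<and> (\<forall>z\<in>M. inner (x - y) z = 0)"
proof -
  obtain y where y: "y \<in> M" and min: "\<And>z. z \<in> M \<Longrightarrow> (norm (x - y))\<^sup>2 \<le> (norm (x - z))\<^sup>2"
    using nearest_point_exists[OF M] by blast
  have "inner (x - y) z = 0" if z: "z \<in> M" for z
  proof (cases "z = 0")
    case False
    \<comment> \<open>This multiple of \<open>z\<close> is the one nearest to \<open>x - y\<close>;
      moving \<open>y\<close> by it would improve on the minimum unless
      \<open>inner (x - y) z = 0\<close>.\<close>
    define t where "t = inner (x - y) z / inner z z"
    have "y + t *\<^sub>R z \<in> M" using M y z by (simp add: subspace_add subspace_scale)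
    from min[OF this] have "(norm (x - y))\<^sup>2 \<le> (norm ((x - y) - t *\<^sub>R z))\<^sup>2"
      by (simp add: algebra_simps)
    also have "\<dots> = (norm (x - y))\<^sup>2 - 2 * t * inner (x - y) z + t\<^sup>2 * inner z z"
      by (simp only: power2_norm_eq_inner inner_diff_left[of "x - y" "t *\<^sub>R z"] inner_diff_right[of _ "x - y"]
          inner_scaleR_left inner_scaleR_right inner_commute[of z "x - y"])
        (simp add: power2_eq_square algebra_simps)
    also have "\<dots> = (norm (x - y))\<^sup>2 - (inner (x - y) z)\<^sup>2 / inner z z"
      using False by (simp add: t_def power2_eq_square field_simps)
    finally have "(inner (x - y) z)\<^sup>2 / inner z z \<le> 0" by simp
    with False show ?thesis
      using inner_gt_zero_iff[of z] by (auto simp add: divide_le_0_iff simp del: inner_gt_zero_iff)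
  qed simp
  with y show ?thesis using proj_unique_aux[OF M(1)] by blast
qed

lemma
  fixes M :: "'a::{real_inner,complete_space} set"
  assumes M: "subspace M" "closed M"
  shows proj_in: "proj M x \<in> M"
    and proj_orth: "z \<in> M \<Longrightarrow> inner (x - proj M x) z = 0"
    and proj_eqI: "y \<in> M \<Longrightarrow> (\<And>z. z \<in> M \<Longrightarrow> inner (x - y) z = 0) \<Longrightarrow> proj M x = y"
proof -
  show "proj M x \<in> M"
    using theI'[OF proj_ex1[OF M, of x]] by (simp add: proj_def)
  show orth: "inner (x - proj M x) z = 0" if "z \<in> M" for z
    using theI'[OF proj_ex1[OF M, of x]] that by (simp add: proj_def)
  show "proj M x = y" if "y \<in> M" "\<And>z. z \<in> M \<Longrightarrow> inner (x - y) z = 0"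
    using that \<open>proj M x \<in> M\<close> orth by (intro proj_unique_aux[OF M(1)]) auto
qed

text \<open>For \<open>x\<close> in \<open>M\<close> the residual \<open>x - proj R x\<close> lies
  in \<open>M\<close> and is orthogonal to \<open>R\<close>. Surjectivity is proved below in this
  form: closed range and trivial orthogonal complement.\<close>

lemma eq_if_orthogonal_trivial:
  fixes M :: "'a::{real_inner,complete_space} set"
  assumes "subspace R" "closed R" "subspace M" "R \<subseteq> M"
    and "\<And>w. w \<in> M \<Longrightarrow> (\<And>r. r \<in> R \<Longrightarrow> inner r w = 0) \<Longrightarrow> w = 0"
  shows "R = M"
proof
  show "M \<subseteq> R"
  proof
    fix x assume "x \<in> M"
    then have "x - proj R x \<in> M"
      using assms proj_in subspace_diff by blast
    with assms proj_orth[of R] have "x - proj R x = 0"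
      by (metis inner_commute)
    then show "x \<in> R" using proj_in[OF assms(1,2), of x] by simp
  qed
qed fact

lemma proj_add: "subspace M \<Longrightarrow> closed M \<Longrightarrow> proj M (x + y) = proj M x + proj M (y::'a::{real_inner,complete_space})"
  by (rule proj_eqI)
    (auto intro: subspace_add proj_in simp: add_diff_add inner_add_left proj_orth)

lemma proj_scaleR: "subspace M \<Longrightarrow> closed M \<Longrightarrow> proj M (r *\<^sub>R y) = r *\<^sub>R proj M (y::'a::{real_inner,complete_space})"
  by (rule proj_eqI)
    (auto intro: subspace_scale proj_in simp: scaleR_diff_right[symmetric] proj_orth)

lemma proj_diff: "subspace M \<Longrightarrow> closed M \<Longrightarrow> proj M (x - y) = proj M x - proj M (y::'a::{real_inner,complete_space})"
  using proj_add[of M x "-y"] proj_scaleR[of M "-1" y] by simp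

lemma proj_proj_subset:
  fixes x :: "'a::{real_inner,complete_space}"
  assumes "subspace M" "closed M" "subspace N" "closed N" "M \<subseteq> N"
  shows "proj M (proj N x) = proj M x"
proof (rule proj_eqI[OF assms(1,2)])
  fix z assume "z \<in> M"
  then have "inner (x - proj M x) z = 0" "inner (x - proj N x) z = 0"
    using assms proj_orth by blast+
  then show "inner (proj N x - proj M x) z = 0"
    by (simp add: inner_diff_left)
qed (use assms proj_in in blast)

lemma inner_proj:
  fixes x :: "'a::{real_inner,complete_space}"
  assumes "subspace M" "closed M"
  shows "inner (proj M x) x = (norm (proj M x))\<^sup>2"
  using proj_orth[OF assms proj_in[OF assms], of x x] inner_commute[of x "proj M x"]
  by (simp add: inner_diff_left power2_norm_eq_inner)

lemma norm_diff_proj: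
  fixes x :: "'a::{real_inner,complete_space}"
  assumes "subspace M" "closed M"
  shows "(norm (x - proj M x))\<^sup>2 = (norm x)\<^sup>2 - (norm (proj M x))\<^sup>2"
proof -
  have "(norm (x - proj M x))\<^sup>2 = (norm x)\<^sup>2 - 2 * inner (proj M x) x + (norm (proj M x))\<^sup>2"
    using inner_commute[of x "proj M x"]
    by (simp add: power2_norm_eq_inner inner_diff_left inner_diff_right)
  then show ?thesis using inner_proj[OF assms, of x] by simp
qed

subsection \<open>Symmetric operators\<close>

locale symmetric_operator =
  fixes D :: "'a::real_inner set" and A :: "'a \<Rightarrow> 'a"
  assumes subspace_D: "subspace D"
    and add: "x \<in> D \<Longrightarrow> y \<in> D \<Longrightarrow> A (x + y) = A x + A y"
    and scale: "x \<in> D \<Longrightarrow> A (r *\<^sub>R x) = r *\<^sub>R A x"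
    and symmetric: "x \<in> D \<Longrightarrow> y \<in> D \<Longrightarrow> inner (A x) y = inner x (A y)"
begin

lemma diff: "x \<in> D \<Longrightarrow> y \<in> D \<Longrightarrow> A (x - y) = A x - A y"
  using add[of x "- y"] scale[of y "-1"] subspace_neg[OF subspace_D, of y] by simp

lemma zero: "A 0 = 0"
  using scale[of 0 0] subspace_0[OF subspace_D] by simp

lemma subspace_image:
  assumes "subspace M" "M \<subseteq> D"
  shows "subspace (A ` M)"
proof (rule subspaceI)
  show "0 \<in> A ` M" using zero subspace_0[OF assms(1)] by (metis imageI)
  fix u v assume "u \<in> A ` M" "v \<in> A ` M"
  then obtain x y where "x \<in> M" "y \<in> M" "u = A x" "v = A y" by blast
  then show "u + v \<in> A ` M"
    using add[of x y] assms subspace_add[of M x y] by (metis imageI subsetD)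
next
  fix c u assume "u \<in> A ` M"
  then obtain x where "x \<in> M" "u = A x" by blast
  then show "c *\<^sub>R u \<in> A ` M"
    using scale[of x c] assms subspace_scale[of M x c] by (metis imageI subsetD)
qed

lemma restrict: "subspace M \<Longrightarrow> M \<subseteq> D \<Longrightarrow> symmetric_operator M A"
  using add scale symmetric by unfold_locales blast+

text \<open>Evaluate the form of \<open>A\<close> at \<open>K x - A x\<close>.\<close>

lemma norm_square_le_form:
  assumes inv: "A ` D \<subseteq> D" and "K \<ge> 0"
    and pos: "\<And>x. x \<in> D \<Longrightarrow> 0 \<le> inner (A x) x"
    and bound: "\<And>x. x \<in> D \<Longrightarrow> inner (A x) x \<le> K * (norm x)\<^sup>2"
    and x: "x \<in> D"
  shows "(norm (A x))\<^sup>2 \<le> K * inner (A x) x"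
proof -
  \<comment> \<open>The last step cancels \<open>L\<close>, so \<open>L\<close> must be positive. If
    \<open>K = 0\<close>, the form vanishes and \<open>L = 1\<close> serves.\<close>
  have *: "(norm (A x))\<^sup>2 \<le> L * inner (A x) x" if "K \<le> L" "L > 0" for L
  proof -
    have Ax: "A x \<in> D" using inv x by blast
    have Lx: "L *\<^sub>R x \<in> D" using x subspace_D by (simp add: subspace_scale)
    have "0 \<le> inner (A (L *\<^sub>R x - A x)) (L *\<^sub>R x - A x)"
      using Ax Lx subspace_D by (intro pos subspace_diff)
    also have "A (L *\<^sub>R x - A x) = L *\<^sub>R A x - A (A x)"
      using diff[OF Lx Ax] scale[OF x] by simp
    also have "inner (L *\<^sub>R A x - A (A x)) (L *\<^sub>R x - A x)
        = L * L * inner (A x) x - 2 * L * (norm (A x))\<^sup>2 + inner (A (A x)) (A x)"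
      using symmetric[OF Ax x]
      by (simp add: inner_diff_left inner_diff_right power2_norm_eq_inner algebra_simps)
    also have "inner (A (A x)) (A x) \<le> L * (norm (A x))\<^sup>2"
      using bound[OF Ax] \<open>K \<le> L\<close> mult_right_mono[of K L "(norm (A x))\<^sup>2"] by simp
    finally have "L * (norm (A x))\<^sup>2 \<le> L * (L * inner (A x) x)"
      by (simp add: algebra_simps)
    then show ?thesis using \<open>L > 0\<close> by simp
  qed
  show ?thesis
  proof (cases "K = 0")
    case True
    then have "inner (A x) x = 0" using pos[OF x] bound[OF x] by simp
    then show ?thesis using *[of 1] True by simp
  qed (use * \<open>K \<ge> 0\<close> in simp)
qed

text \<open>Insert the form bound into \<open>norm_square_le_form\<close>. This is the passage from
  \<open>A <= K\<close> as forms to a norm bound on an invariant subspace.\<close>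

lemma norm_le_of_form_le:
  assumes inv: "A ` D \<subseteq> D" and "K \<ge> 0"
    and pos: "\<And>x. x \<in> D \<Longrightarrow> 0 \<le> inner (A x) x"
    and bound: "\<And>x. x \<in> D \<Longrightarrow> inner (A x) x \<le> K * (norm x)\<^sup>2"
    and x: "x \<in> D"
  shows "norm (A x) \<le> K * norm x"
proof -
  have "(norm (A x))\<^sup>2 \<le> K * (K * (norm x)\<^sup>2)"
    using norm_square_le_form[OF assms] mult_left_mono[OF bound[OF x] \<open>K \<ge> 0\<close>] by linarith
  also have "\<dots> = (K * norm x)\<^sup>2" by (simp add: power2_eq_square)
  finally show ?thesis using \<open>K \<ge> 0\<close> by (auto intro: power2_le_imp_le)
qed

end

section \<open>Closed range and surjectivity of operators that are bounded below\<close>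

lemma closed_range_if_bounded_below:
  fixes D :: "'a::{real_inner,complete_space} set"
  assumes "c > 0" and "subspace D"
    and diff: "\<And>x y. x \<in> D \<Longrightarrow> y \<in> D \<Longrightarrow> T (x - y) = T x - T y"
    and below: "\<And>x. x \<in> D \<Longrightarrow> c * norm x \<le> norm (T x)"
    and graph: "\<And>X x y. (\<And>n::nat. X n \<in> D) \<Longrightarrow> X \<longlonglongrightarrow> x \<Longrightarrow> (\<lambda>n. T (X n)) \<longlonglongrightarrow> y \<Longrightarrow> x \<in> D \<and> T x = (y::'a)"
  shows "closed (T ` D)"
  unfolding closed_sequential_limits
proof (intro allI impI, elim conjE)
  fix Y y assume "\<forall>n::nat. Y n \<in> T ` D" and Y: "Y \<longlonglongrightarrow> y"
  then obtain X where X: "\<And>n. X n \<in> D" and TX: "\<And>n. Y n = T (X n)"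
    unfolding image_iff by metis
  \<comment> \<open>The lower bound carries the Cauchy property of the images back to
    \<open>X\<close>.\<close>
  have "Cauchy X"
  proof (rule CauchyI)
    fix e :: real assume "0 < e"
    then have "0 < c * e" using \<open>c > 0\<close> by simp
    then obtain N where N: "\<And>m n. m \<ge> N \<Longrightarrow> n \<ge> N \<Longrightarrow> norm (Y m - Y n) < c * e"
      using LIMSEQ_imp_Cauchy[OF Y] CauchyD by blast
    have "norm (X m - X n) < e" if "m \<ge> N" "n \<ge> N" for m n
    proof -
      have "c * norm (X m - X n) \<le> norm (T (X m - X n))"
        using X \<open>subspace D\<close> by (intro below subspace_diff)
      also have "\<dots> < c * e" using N[OF that] by (simp add: TX diff X)
      finally show ?thesis using \<open>c > 0\<close> by simp
    qed
    then show "\<exists>N. \<forall>m\<ge>N. \<forall>n\<ge>N. norm (X m - X n) < e" by blast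
  qed
  then obtain x where "X \<longlonglongrightarrow> x" using Cauchy_convergent convergent_def by blast
  moreover have "(\<lambda>n. T (X n)) \<longlonglongrightarrow> y" using Y by (simp add: TX[symmetric])
  ultimately show "y \<in> T ` D" using graph[of X x y] X by blast
qed


text \<open>The lower bound closes the range. If \<open>w\<close> in \<open>M\<close> is orthogonal
  to it, then \<open>(norm (T w))^2 = inner (T (T w)) w = 0\<close>, and the lower bound gives
  \<open>w = 0\<close>.\<close>

lemma symmetric_surj_if_bounded_below:
  fixes M :: "'a::{real_inner,complete_space} set"
  assumes "symmetric_operator M T" and "closed M" and inv: "T ` M \<subseteq> M"
    and bound: "\<And>x. x \<in> M \<Longrightarrow> norm (T x) \<le> K * norm x"
    and "c > 0" and below: "\<And>x. x \<in> M \<Longrightarrow> c * norm x \<le> norm (T x)"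
  shows "T ` M = M"
proof (rule eq_if_orthogonal_trivial)
  interpret symmetric_operator M T by fact
  show "subspace (T ` M)" "subspace M"
    using subspace_image subspace_D by auto
  show "closed (T ` M)"
  proof (rule closed_range_if_bounded_below[OF \<open>c > 0\<close> subspace_D diff below])
    fix X x y assume X: "\<And>n::nat. X n \<in> M" "X \<longlonglongrightarrow> x" "(\<lambda>n. T (X n)) \<longlonglongrightarrow> y"
    have x: "x \<in> M" using \<open>closed M\<close> X closed_sequentially by blast
    have "(\<lambda>n. T (X n) - T x) \<longlonglongrightarrow> 0"
    proof (rule Lim_null_comparison)
      show "\<forall>\<^sub>F n in sequentially. norm (T (X n) - T x) \<le> K * norm (X n - x)"
        using X x bound[OF subspace_diff[OF subspace_D]] by (simp add: diff)
      show "(\<lambda>n. K * norm (X n - x)) \<longlonglongrightarrow> 0"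
        using X(2) by (intro tendsto_mult_right_zero tendsto_norm_zero) (simp add: LIM_zero_iff)
    qed
    then have "(\<lambda>n. T (X n)) \<longlonglongrightarrow> T x" by (simp add: LIM_zero_iff)
    with x X(3) show "x \<in> M \<and> T x = y" using LIMSEQ_unique by blast
  qed
  fix w assume w: "w \<in> M" and "\<And>r. r \<in> T ` M \<Longrightarrow> inner r w = 0"
  then have "inner (T (T w)) w = 0" using inv by blast
  then have "T w = 0" using w inv symmetric[of "T w" w] by auto
  then have "c * norm w \<le> 0" using below[OF w] by simp
  then show "w = 0" using \<open>c > 0\<close> by (simp add: mult_le_0_iff)
qed fact

subsection \<open>The absolute value of a bounded symmetric operator\<close>

lemma symmetric_operator_bounded_linear:
  assumes "symmetric_operator UNIV T" "\<And>x. norm (T x) \<le> K * norm x"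
  shows "bounded_linear T"
proof -
  interpret symmetric_operator UNIV T by fact
  show ?thesis
    using assms(2) by (intro bounded_linear_intro[of _ K]) (simp_all add: add scale mult.commute)
qed

text \<open>If \<open>L\<close> is the limit of this iteration, \<open>1 - L\<close> is a square root of \<open>1 - S\<close>. The norms of its
  increments are dominated by the increments of the scalar iteration for \<open>S = 1\<close>.\<close>

primrec sqrt_iter :: "('a::real_vector \<Rightarrow> 'a) \<Rightarrow> nat \<Rightarrow> 'a \<Rightarrow> 'a" where
  "sqrt_iter S 0 x = 0"
| "sqrt_iter S (Suc n) x = (1/2) *\<^sub>R (S x + sqrt_iter S n (sqrt_iter S n x))"

primrec scalar_iter :: "nat \<Rightarrow> real" where
  "scalar_iter 0 = 0"
| "scalar_iter (Suc n) = (1 + (scalar_iter n)\<^sup>2) / 2"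

lemma scalar_iter_bounds: "0 \<le> scalar_iter n \<and> scalar_iter n \<le> 1"
proof (induction n)
  case (Suc n)
  then have "(scalar_iter n)\<^sup>2 \<le> 1" by (simp add: power_le_one)
  then show ?case by simp
qed simp

lemma scalar_iter_mono: "scalar_iter n \<le> scalar_iter (Suc n)"
proof -
  have "2 * scalar_iter n \<le> 1 + (scalar_iter n)\<^sup>2"
    using zero_le_power2[of "scalar_iter n - 1"] by (simp add: power2_eq_square algebra_simps)
  then show ?thesis by simp
qed

lemma Cauchy_scalar_iter: "Cauchy scalar_iter"
proof -
  have "incseq scalar_iter" using scalar_iter_mono by (rule incseq_SucI)
  then show ?thesis
    using scalar_iter_bounds incseq_convergent[of scalar_iter 1] LIMSEQ_imp_Cauchy by metis
qed

locale contraction_sqrt = symmetric_operator UNIV S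
  for S :: "'a::{real_inner,complete_space} \<Rightarrow> 'a" +
  assumes norm_le: "norm (S x) \<le> norm x"
begin

abbreviation Y where "Y \<equiv> sqrt_iter S"

lemma norm_Y: "norm (Y n x) \<le> scalar_iter n * norm x"
proof (induction n arbitrary: x)
  case (Suc n)
  have "norm (Y n (Y n x)) \<le> scalar_iter n * (scalar_iter n * norm x)"
    using Suc[of "Y n x"] mult_left_mono[OF Suc[of x], of "scalar_iter n"] scalar_iter_bounds[of n]
    by linarith
  then have "norm (S x + Y n (Y n x)) \<le> norm x + (scalar_iter n)\<^sup>2 * norm x"
    using norm_le[of x] by (intro norm_triangle_le) (simp add: power2_eq_square)
  moreover have "norm (Y (Suc n) x) = norm (S x + Y n (Y n x)) / 2"
    by (simp del: scaleR_add_right)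
  ultimately show ?case by (simp add: algebra_simps)
qed simp

lemma norm_Y_le: "norm (Y n x) \<le> norm x"
  using norm_Y[of n x] mult_right_mono[of "scalar_iter n" 1 "norm x"] scalar_iter_bounds[of n] by simp

lemma symmetric_Y: "symmetric_operator UNIV (Y n)"
proof (induction n)
  case 0
  show ?case by unfold_locales auto
next
  case (Suc n)
  then interpret Yn: symmetric_operator UNIV "Y n" .
  show ?case
    by unfold_locales
      (simp_all add: add scale Yn.add Yn.scale algebra_simps symmetric Yn.symmetric
        inner_add_left inner_add_right)
qed

lemma bounded_linear_Y: "bounded_linear (Y n)"
  using symmetric_Y norm_Y by (rule symmetric_operator_bounded_linear)

text \<open>Each \<open>Y n\<close> is a polynomial in \<open>S\<close>.\<close>

lemma commute_Y:
  assumes "bounded_linear Q" "\<And>x. Q (S x) = S (Q x)"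
  shows "Q (Y n x) = Y n (Q x)"
proof -
  interpret bounded_linear Q by fact
  show ?thesis
    by (induction n arbitrary: x) (simp_all add: zero add scale assms(2))
qed

lemma Y_commute_Y: "Y m (Y n x) = Y n (Y m x)"
proof (rule commute_Y[OF bounded_linear_Y])
  fix x
  have "bounded_linear S"
    using symmetric_operator_axioms norm_le
    by (intro symmetric_operator_bounded_linear[where K = 1]) auto
  then show "Y m (S x) = S (Y m x)"
    using commute_Y[of S m x] by simp
qed

text \<open>The \<open>Y n\<close> commute, so the difference of the squares of
  \<open>Y (Suc n)\<close> and \<open>Y n\<close> factors into sum times difference, just as for the
  scalar iteration; the induction hypothesis bounds the difference.\<close>

lemma norm_Y_increment:
  "norm (Y (Suc n) x - Y n x) \<le> (scalar_iter (Suc n) - scalar_iter n) * norm x"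
proof (induction n arbitrary: x)
  case 0
  show ?case using norm_le[of x] by simp
next
  case (Suc n)
  let ?y = scalar_iter
  interpret Y: bounded_linear "Y (Suc n)" by (rule bounded_linear_Y)
  interpret Yn: bounded_linear "Y n" by (rule bounded_linear_Y)
  define d where "d = Y (Suc n) x - Y n x"
  have "Y (Suc (Suc n)) x - Y (Suc n) x = (1/2) *\<^sub>R (Y (Suc n) (Y (Suc n) x) - Y n (Y n x))"
    unfolding sqrt_iter.simps(2)[of S "Suc n" x] sqrt_iter.simps(2)[of S n x]
    by (simp add: scaleR_diff_right[symmetric] del: sqrt_iter.simps)
  also have "Y (Suc n) (Y (Suc n) x) - Y n (Y n x) = Y (Suc n) d + Y n d"
    using Y_commute_Y[of n "Suc n" x]
    by (simp add: d_def Y.diff Yn.diff del: sqrt_iter.simps)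
  finally have eq: "Y (Suc (Suc n)) x - Y (Suc n) x = (1/2) *\<^sub>R (Y (Suc n) d + Y n d)" .
  have "norm (Y (Suc n) d + Y n d) \<le> (?y (Suc n) + ?y n) * norm d"
    using norm_Y[of "Suc n" d] norm_Y[of n d] norm_triangle_ineq[of "Y (Suc n) d" "Y n d"]
    by (simp add: distrib_right del: sqrt_iter.simps scalar_iter.simps)
  also have "\<dots> \<le> (?y (Suc n) + ?y n) * ((?y (Suc n) - ?y n) * norm x)"
    using Suc[of x] scalar_iter_bounds[of n] scalar_iter_bounds[of "Suc n"]
    unfolding d_def by (intro mult_left_mono) linarith+
  also have "\<dots> = 2 * ((?y (Suc (Suc n)) - ?y (Suc n)) * norm x)"
  proof -
    have "(?y (Suc n) + ?y n) * (?y (Suc n) - ?y n) = 2 * (?y (Suc (Suc n)) - ?y (Suc n))"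
      unfolding scalar_iter.simps(2)[of "Suc n"]
      using scalar_iter.simps(2)[of n] by (simp add: power2_eq_square algebra_simps del: scalar_iter.simps)
    then show ?thesis by (simp only: mult.assoc[symmetric])
  qed
  finally show ?case unfolding eq by simp
qed

lemma norm_Y_diff:
  assumes "n \<le> m"
  shows "norm (Y m x - Y n x) \<le> (scalar_iter m - scalar_iter n) * norm x"
  using assms
proof (induction m rule: dec_induct)
  case (step m)
  have "norm (Y (Suc m) x - Y n x) \<le> norm (Y (Suc m) x - Y m x) + norm (Y m x - Y n x)"
    using norm_triangle_ineq[of "Y (Suc m) x - Y m x" "Y m x - Y n x"] by simp
  also have "\<dots> \<le> (scalar_iter (Suc m) - scalar_iter m) * norm x + (scalar_iter m - scalar_iter n) * norm x"
    using step norm_Y_increment[of m x] by (intro add_mono)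
  finally show ?case by (simp add: algebra_simps del: sqrt_iter.simps scalar_iter.simps)
qed simp

lemma Cauchy_Y: "Cauchy (\<lambda>n. Y n x)"
proof (rule CauchyI')
  fix e :: real assume "0 < e"
  then have "0 < e / (norm x + 1)" by (simp add: add_nonneg_pos)
  from CauchyD[OF Cauchy_scalar_iter this] obtain N where
    N: "\<And>m n. N \<le> m \<Longrightarrow> N \<le> n \<Longrightarrow> norm (scalar_iter m - scalar_iter n) < e / (norm x + 1)"
    by blast
  have "dist (Y m x) (Y n x) < e" if "N \<le> m" "m < n" for m n
  proof -
    have "dist (Y m x) (Y n x) \<le> (scalar_iter n - scalar_iter m) * norm x"
      using norm_Y_diff[of m n x] that by (simp add: dist_norm norm_minus_commute)
    also have "\<dots> \<le> norm (scalar_iter n - scalar_iter m) * (norm x + 1)"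
      by (intro mult_mono) auto
    also have "\<dots> < e"
      using N[of n m] that by (simp add: pos_less_divide_eq add_nonneg_pos)
    finally show ?thesis .
  qed
  then show "\<exists>N. \<forall>m\<ge>N. \<forall>n>m. dist (Y m x) (Y n x) < e" by blast
qed

definition L where "L x = lim (\<lambda>n. Y n x)"

lemma Y_tendsto: "(\<lambda>n. Y n x) \<longlonglongrightarrow> L x"
  unfolding L_def using Cauchy_Y Cauchy_convergent convergent_LIMSEQ_iff by blast

lemma symmetric_L: "symmetric_operator UNIV L"
proof unfold_locales
  fix x y r
  have "(\<lambda>n. Y n (x + y)) \<longlonglongrightarrow> L x + L y"
    using tendsto_add[OF Y_tendsto[of x] Y_tendsto[of y]]
    by (simp add: linear_simps[OF bounded_linear_Y])
  then show "L (x + y) = L x + L y" using Y_tendsto LIMSEQ_unique by blast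
  have "(\<lambda>n. Y n (r *\<^sub>R x)) \<longlonglongrightarrow> r *\<^sub>R L x"
    using tendsto_scaleR[OF tendsto_const Y_tendsto[of x]]
    by (simp add: linear_simps[OF bounded_linear_Y])
  then show "L (r *\<^sub>R x) = r *\<^sub>R L x" using Y_tendsto LIMSEQ_unique by blast
  have "(\<lambda>n. inner (Y n x) y) \<longlonglongrightarrow> inner (L x) y" "(\<lambda>n. inner x (Y n y)) \<longlonglongrightarrow> inner x (L y)"
    by (intro tendsto_intros Y_tendsto)+
  moreover have "inner (Y n x) y = inner x (Y n y)" for n
    using symmetric_operator.symmetric[OF symmetric_Y] by simp
  ultimately show "inner (L x) y = inner x (L y)" using LIMSEQ_unique by simp
qed auto

lemma norm_L: "norm (L x) \<le> norm x"
  using LIMSEQ_le_const2[OF tendsto_norm[OF Y_tendsto]] norm_Y_le by blast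

lemma L_eq: "L x = (1/2) *\<^sub>R (S x + L (L x))"
proof -
  \<comment> \<open>The \<open>Y n\<close> are uniformly contractive, so \<open>Y n (Y n x)\<close>
    and \<open>Y n (L x)\<close> have the same limit.\<close>
  have "(\<lambda>n. Y n (Y n x - L x)) \<longlonglongrightarrow> 0"
  proof (rule Lim_null_comparison)
    show "\<forall>\<^sub>F n in sequentially. norm (Y n (Y n x - L x)) \<le> norm (Y n x - L x)"
      using norm_Y_le by simp
    show "(\<lambda>n. norm (Y n x - L x)) \<longlonglongrightarrow> 0"
      using Y_tendsto[of x] by (intro tendsto_norm_zero) (simp add: LIM_zero_iff)
  qed
  from tendsto_add[OF this Y_tendsto[of "L x"]] have "(\<lambda>n. Y n (Y n x)) \<longlonglongrightarrow> L (L x)"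
    by (simp add: linear_simps[OF bounded_linear_Y])
  then have "(\<lambda>n. Y (Suc n) x) \<longlonglongrightarrow> (1/2) *\<^sub>R (S x + L (L x))"
    unfolding sqrt_iter.simps by (intro tendsto_intros)
  then show ?thesis
    using LIMSEQ_Suc[OF Y_tendsto[of x]] LIMSEQ_unique by blast
qed

lemma commute_L:
  assumes "bounded_linear Q" "\<And>x. Q (S x) = S (Q x)"
  shows "Q (L x) = L (Q x)"
proof -
  have "(\<lambda>n. Q (Y n x)) \<longlonglongrightarrow> Q (L x)"
    using bounded_linear.tendsto[OF assms(1) Y_tendsto] .
  then show ?thesis
    using commute_Y[OF assms] Y_tendsto[of "Q x"] LIMSEQ_unique by simp
qed

end

text \<open>For \<open>S = 1 - T^2 / K^2\<close> one has \<open>0 <= S <= 1\<close>, so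
  \<open>S\<close> is a contraction. The limit \<open>L\<close> solves \<open>2 L = S + L^2\<close>,
  that is \<open>(1 - L)^2 = T^2 / K^2\<close>; take \<open>R = K (1 - L)\<close>. It commutes with
  \<open>T\<close> because \<open>L\<close> is a limit of polynomials in \<open>S\<close>, and it is
  nonnegative because \<open>norm (L x) <= norm x\<close>.\<close>

lemma symmetric_abs_exists:
  fixes T :: "'a::{real_inner,complete_space} \<Rightarrow> 'a"
  assumes T: "symmetric_operator UNIV T" and bound: "\<And>x. norm (T x) \<le> K * norm x" and "K > 0"
  obtains R where "symmetric_operator UNIV R" "\<And>x. R (R x) = T (T x)"
    "\<And>x. R (T x) = T (R x)" "\<And>x. 0 \<le> inner (R x) x"
proof -
  interpret T: symmetric_operator UNIV T by fact
  define S where "S x = x - (1/K\<^sup>2) *\<^sub>R T (T x)" for x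
  have sym_S: "symmetric_operator UNIV S"
    by unfold_locales
      (auto simp: S_def T.add T.scale T.symmetric algebra_simps inner_diff_left inner_diff_right)
  have form_S: "inner (S x) x = (norm x)\<^sup>2 - (norm (T x))\<^sup>2 / K\<^sup>2" for x
    using T.symmetric[of "T x" x] by (simp add: S_def inner_diff_left power2_norm_eq_inner)
  have "norm (S x) \<le> norm x" for x
  proof -
    have "inner (S x) x \<le> 1 * (norm x)\<^sup>2" "0 \<le> inner (S x) x" for x
    proof -
      have "(norm (T x))\<^sup>2 \<le> (K * norm x)\<^sup>2" using bound[of x] by (intro power_mono) auto
      then show "0 \<le> inner (S x) x"
        unfolding form_S using \<open>K > 0\<close> by (simp add: power_mult_distrib field_simps)
    qed (simp add: form_S)
    from symmetric_operator.norm_le_of_form_le[OF sym_S _ _ this(2,1), of x]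
    show ?thesis by simp
  qed
  with sym_S interpret contraction_sqrt S
    unfolding contraction_sqrt_def contraction_sqrt_axioms_def by blast
  interpret L: symmetric_operator UNIV L by (rule symmetric_L)
  define R where "R x = K *\<^sub>R (x - L x)" for x
  have "symmetric_operator UNIV R"
    by unfold_locales
      (auto simp: R_def L.add L.scale L.symmetric algebra_simps inner_diff_left inner_diff_right)
  moreover have "R (R x) = T (T x)" for x
  proof -
    have "R (R x) = K\<^sup>2 *\<^sub>R (x - 2 *\<^sub>R L x + L (L x))"
      by (simp add: R_def L.scale L.diff power2_eq_square algebra_simps scaleR_2)
    also have "2 *\<^sub>R L x = S x + L (L x)"
      using arg_cong[OF L_eq[of x], of "scaleR 2"] by simp
    finally show ?thesis using \<open>K > 0\<close> by (simp add: S_def[of x])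
  qed
  moreover have "R (T x) = T (R x)" for x
  proof -
    have "T (L x) = L (T x)"
      using symmetric_operator_bounded_linear[OF T bound]
      by (rule commute_L) (simp add: S_def T.diff T.scale)
    then show ?thesis by (simp add: R_def T.diff T.scale)
  qed
  moreover have "0 \<le> inner (R x) x" for x
  proof -
    have "inner (L x) x \<le> norm x * norm x"
      using norm_cauchy_schwarz[of "L x" x] mult_right_mono[OF norm_L[of x], of "norm x"] by simp
    then show ?thesis
      using \<open>K > 0\<close> by (simp add: R_def inner_diff_left power2_norm_eq_inner[symmetric] power2_eq_square)
  qed
  ultimately show ?thesis by (rule that)
qed

subsection \<open>The spaces \<open>F(A, t)\<close>\<close>

text \<open>The assumption \<open>adjoint\<close> says that \<open>A\<close> and its adjoint have
  the same graph, hence also the same domain. Only the real inner product occurs;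
  \<open>nonneg_self_adjointI\<close> enters this locale from either scalar field.\<close>

locale nonneg_self_adjoint =
  fixes D :: "'a::{real_inner,complete_space} set" and A :: "'a \<Rightarrow> 'a"
  assumes subspace_dom: "subspace D"
    and dom_add: "x \<in> D \<Longrightarrow> y \<in> D \<Longrightarrow> A (x + y) = A x + A y"
    and dom_scale: "x \<in> D \<Longrightarrow> A (r *\<^sub>R x) = r *\<^sub>R A x"
    and dense: "closure D = UNIV"
    and adjoint: "(\<forall>x\<in>D. inner (A x) y = inner x z) \<longleftrightarrow> y \<in> D \<and> A y = z"
    and nonneg: "x \<in> D \<Longrightarrow> 0 \<le> inner (A x) x"
begin

sublocale symmetric_operator D A
  using subspace_dom dom_add dom_scale adjoint by unfold_locales blast+

text \<open>The graph of an adjoint is cut out by the equations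
  \<open>inner (A w) x = inner w z\<close>, which survive limits.\<close>

lemma closed_graph:
  assumes X: "\<And>n::nat. X n \<in> D" "X \<longlonglongrightarrow> x" "(\<lambda>n. A (X n)) \<longlonglongrightarrow> z"
  shows "x \<in> D \<and> A x = z"
proof -
  have "inner (A w) x = inner w z" if "w \<in> D" for w
  proof -
    have "(\<lambda>n. inner (A w) (X n)) \<longlonglongrightarrow> inner (A w) x" "(\<lambda>n. inner w (A (X n))) \<longlonglongrightarrow> inner w z"
      by (intro tendsto_intros X)+
    then show ?thesis using symmetric[OF that X(1)] LIMSEQ_unique by simp
  qed
  then show ?thesis using adjoint by blast
qed

section \<open>The resolvent of \<open>A\<close> at -1\<close>

definition V where "V x = x + A x"

lemma norm_le_V: "x \<in> D \<Longrightarrow> norm x \<le> norm (V x)"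
proof -
  assume x: "x \<in> D"
  have "(norm x)\<^sup>2 \<le> inner (V x) x"
    using nonneg[OF x] by (simp add: V_def inner_add_left power2_norm_eq_inner)
  also have "\<dots> \<le> norm (V x) * norm x" by (rule norm_cauchy_schwarz)
  finally show ?thesis
    by (cases "norm x = 0") (simp_all add: power2_eq_square)
qed

lemma V_diff: "x \<in> D \<Longrightarrow> y \<in> D \<Longrightarrow> V (x - y) = V x - V y"
  by (simp add: V_def diff)

lemma symmetric_V: "symmetric_operator D V"
  using subspace_dom
  by unfold_locales (simp_all add: V_def add scale symmetric inner_add_left inner_add_right algebra_simps)

lemma inj_on_V: "inj_on V D"
proof (rule inj_onI)
  fix x y assume xy: "x \<in> D" "y \<in> D" "V x = V y"
  then have "norm (x - y) \<le> norm (V (x - y))"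
    by (intro norm_le_V subspace_diff[OF subspace_dom])
  with xy show "x = y" by (simp add: V_diff)
qed

text \<open>A vector \<open>w\<close> orthogonal to the range satisfies \<open>A w = - w\<close> by
  self-adjointness, so \<open>w = 0\<close> because \<open>A >= 0\<close>. The range is closed since
  \<open>V\<close> is bounded below and has a closed graph.\<close>

lemma range_V: "V ` D = UNIV"
proof (rule eq_if_orthogonal_trivial)
  show "subspace (V ` D)"
    using symmetric_operator.subspace_image[OF symmetric_V subspace_dom] by blast
  show "closed (V ` D)"
  proof (rule closed_range_if_bounded_below[of 1, OF _ subspace_dom V_diff])
    fix X x y assume X: "\<And>n::nat. X n \<in> D" "X \<longlonglongrightarrow> x" "(\<lambda>n. V (X n)) \<longlonglongrightarrow> y"
    have "(\<lambda>n. V (X n) - X n) \<longlonglongrightarrow> y - x" by (intro tendsto_intros X)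
    then have "x \<in> D \<and> A x = y - x"
      using X by (intro closed_graph[of X]) (simp_all add: V_def)
    then show "x \<in> D \<and> V x = y" by (simp add: V_def)
  qed (simp_all add: norm_le_V)
  fix w assume w: "\<And>r. r \<in> V ` D \<Longrightarrow> inner r w = 0"
  have "inner (A x) w = inner x (- w)" if "x \<in> D" for x
    using w[of "V x"] that by (simp add: V_def inner_add_left)
  then have "w \<in> D" "A w = - w" using adjoint[of w "- w"] by blast+
  then have "(norm w)\<^sup>2 \<le> 0" using nonneg[of w] by (simp add: power2_norm_eq_inner)
  then show "w = 0" by simp
qed auto

definition B where "B = inv_into D V"

lemma B_in: "B u \<in> D"
  unfolding B_def using range_V by (intro inv_into_into) simp

lemma V_B: "V (B u) = u"
  unfolding B_def using range_V by (intro f_inv_into_f) simp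

lemma B_V: "x \<in> D \<Longrightarrow> B (V x) = x"
  unfolding B_def using inj_on_V by (rule inv_into_f_f)

lemma A_B: "A (B u) = u - B u"
  using V_B[of u] by (simp add: V_def algebra_simps)

lemma B_eqI: "x \<in> D \<Longrightarrow> V x = u \<Longrightarrow> B u = x"
  using B_V by blast

sublocale B: symmetric_operator UNIV B
proof unfold_locales
  interpret V: symmetric_operator D V by (rule symmetric_V)
  fix x y r
  show "B (x + y) = B x + B y"
    by (rule B_eqI) (simp_all add: V.add B_in V_B subspace_add[OF subspace_dom])
  show "B (r *\<^sub>R x) = r *\<^sub>R B x"
    by (rule B_eqI) (simp_all add: V.scale B_in V_B subspace_scale[OF subspace_dom])
  show "inner (B x) y = inner x (B y)"
    using V.symmetric[OF B_in[of x] B_in[of y]] by (simp add: V_B)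
qed auto

lemma norm_B: "norm (B u) \<le> norm u"
  using norm_le_V[OF B_in] V_B by simp

lemma form_B_ge: "(norm (B u))\<^sup>2 \<le> inner (B u) u"
proof -
  have "inner (B u) u = inner (B u) (B u) + inner (B u) (A (B u))"
    using arg_cong[OF V_B[of u], of "inner (B u)"] by (simp add: V_def inner_add_right)
  then show ?thesis
    using nonneg[OF B_in[of u]] by (simp add: power2_norm_eq_inner inner_commute)
qed

abbreviation F where "F t \<equiv> F_space D A t"

lemma power_dom_iff: "(\<forall>n\<ge>1. x \<in> power_dom D A n) \<longleftrightarrow> (\<forall>n. (A ^^ n) x \<in> D)"
proof
  assume *: "\<forall>n\<ge>1. x \<in> power_dom D A n"
  have "x \<in> power_dom D A (Suc n)" for n using * by (rule allE[of _ "Suc n"]) simp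
  then show "\<forall>n. (A ^^ n) x \<in> D" by simp
next
  assume "\<forall>n. (A ^^ n) x \<in> D"
  then have "x \<in> power_dom D A n" for n by (induction n) auto
  then show "\<forall>n\<ge>1. x \<in> power_dom D A n" by simp
qed

text \<open>The index shifts: \<open>power_dom D A (Suc n)\<close> asks for the iterates up to the
  \<open>n\<close>-th to lie in \<open>D\<close>, so the quantifier may start at 0. The norm
  condition at 0 is trivial.\<close>

lemma F_iff: "x \<in> F t \<longleftrightarrow> (\<forall>n. (A ^^ n) x \<in> D \<and> norm ((A ^^ n) x) \<le> t ^ n * norm x)"
proof -
  have "x \<in> F t \<longleftrightarrow> (\<forall>n. (A ^^ n) x \<in> D) \<and> (\<forall>n\<ge>1. norm ((A ^^ n) x) \<le> t ^ n * norm x)"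
    using power_dom_iff[of x] unfolding F_space_def by auto
  moreover have "norm ((A ^^ n) x) \<le> t ^ n * norm x"
    if "\<forall>n\<ge>1. norm ((A ^^ n) x) \<le> t ^ n * norm x" for n
    using that by (cases n) auto
  ultimately show ?thesis by blast
qed

lemma F_subset_dom: "F t \<subseteq> D"
proof
  fix x assume "x \<in> F t"
  then have "(A ^^ 0) x \<in> D" unfolding F_iff by blast
  then show "x \<in> D" by simp
qed

lemma norm_A_F: "x \<in> F t \<Longrightarrow> norm (A x) \<le> t * norm x"
  unfolding F_iff by (auto dest: spec[of _ 1])

lemma power_zero: "(A ^^ n) 0 = 0"
  by (induction n) (auto simp: zero)

lemma zero_in_F: "0 \<in> F t"
  unfolding F_iff using subspace_0[OF subspace_dom] by (simp add: power_zero)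

text \<open>The condition for \<open>n = 1\<close> already forces this. It makes \<open>E t\<close>
  vanish for \<open>t < 0\<close> and settles the case \<open>t < 0\<close> of the structural facts
  below.\<close>

lemma F_neg: "t < 0 \<Longrightarrow> F t = {0}"
proof -
  assume "t < 0"
  have "x = 0" if "x \<in> F t" for x
  proof (rule ccontr)
    assume "x \<noteq> 0"
    with \<open>t < 0\<close> have "t * norm x < 0" by (simp add: mult_neg_pos)
    then show False using norm_A_F[OF that] norm_ge_zero[of "A x"] by linarith
  qed
  then show ?thesis using zero_in_F by blast
qed

text \<open>The norms of \<open>A\<^sup>n x\<close> are log-convex in \<open>n\<close>; if the first ratio exceeds \<open>t\<close>,
  they outgrow every multiple of \<open>t\<^sup>n\<close>.\<close>

lemma norm_A_le_of_growth:
  assumes dom: "\<And>n. (A ^^ n) x \<in> D" and C: "\<And>n. norm ((A ^^ n) x) \<le> C * t ^ n" and "t \<ge> 0"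
  shows "norm (A x) \<le> t * norm x"
proof (rule ccontr)
  define a where "a n = norm ((A ^^ n) x)" for n
  assume "\<not> norm (A x) \<le> t * norm x"
  then have less: "t * a 0 < a 1" by (simp add: a_def)
  have "a 0 \<noteq> 0" using less by (auto simp: a_def zero)
  then have a0: "a 0 > 0" by (simp add: a_def)
  define r where "r = a 1 / a 0"
  have rt: "t < r" using less a0 by (simp add: r_def pos_less_divide_eq)
  then have r: "r > 0" using \<open>t \<ge> 0\<close> by simp
  have convex: "(a (Suc n))\<^sup>2 \<le> a n * a (Suc (Suc n))" for n
  proof -
    have "(a (Suc n))\<^sup>2 = inner (A ((A ^^ n) x)) ((A ^^ Suc n) x)"
      by (simp add: a_def power2_norm_eq_inner)
    also have "\<dots> = inner ((A ^^ n) x) ((A ^^ Suc (Suc n)) x)"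
      using symmetric[OF dom[of n] dom[of "Suc n"]] by simp
    also have "\<dots> \<le> a n * a (Suc (Suc n))" unfolding a_def by (rule norm_cauchy_schwarz)
    finally show ?thesis .
  qed
  \<comment> \<open>By log-convexity the quotients \<open>a (Suc n) / a n\<close> do not decrease,
    so each is at least the first one, \<open>r\<close>.\<close>
  have ratio: "0 < a n \<and> r * a n \<le> a (Suc n)" for n
  proof (induction n)
    case 0
    then show ?case using a0 by (simp add: r_def)
  next
    case (Suc n)
    then have pos: "0 < a (Suc n)" using r mult_pos_pos[of r "a n"] by linarith
    have "a n * (r * a (Suc n)) = (r * a n) * a (Suc n)" by simp
    also have "\<dots> \<le> a (Suc n) * a (Suc n)"
      using Suc pos by (intro mult_right_mono) auto
    also have "\<dots> \<le> a n * a (Suc (Suc n))" using convex[of n] by (simp add: power2_eq_square)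
    finally show ?case using Suc pos by simp
  qed
  have power: "r ^ n * a 0 \<le> a n" for n
  proof (induction n)
    case (Suc n)
    have "r ^ Suc n * a 0 = r * (r ^ n * a 0)" by simp
    also have "\<dots> \<le> r * a n" using Suc r by (intro mult_left_mono) auto
    finally show ?case using ratio[of n] by linarith
  qed simp
  show False
  proof (cases "t = 0")
    case True
    then have "a 1 \<le> 0" using C[of 1] by (simp add: a_def)
    with less True show False by simp
  next
    case False
    then have t: "t > 0" using \<open>t \<ge> 0\<close> by simp
    then have "1 < r / t" using rt by simp
    then obtain n where n: "C / a 0 < (r / t) ^ n" using real_arch_pow by blast
    have "r ^ n * a 0 \<le> C * t ^ n" using power[of n] C[of n] by (simp add: a_def)
    then have "(r / t) ^ n \<le> C / a 0"
      using a0 t by (simp add: power_divide field_simps)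
    with n show False by simp
  qed
qed

text \<open>The bound \<open>t ^ n * norm x\<close> is not visibly stable under sums or under
  \<open>A\<close>; with a free constant it is. \<open>norm_A_le_of_growth\<close>, applied to every
  iterate of \<open>x\<close>, recovers the sharp bound.\<close>

lemma F_iff_growth:
  assumes "t \<ge> 0"
  shows "x \<in> F t \<longleftrightarrow> (\<forall>n. (A ^^ n) x \<in> D) \<and> (\<exists>C. \<forall>n. norm ((A ^^ n) x) \<le> C * t ^ n)"
proof
  assume "x \<in> F t"
  then show "(\<forall>n. (A ^^ n) x \<in> D) \<and> (\<exists>C. \<forall>n. norm ((A ^^ n) x) \<le> C * t ^ n)"
    unfolding F_iff by (metis mult.commute)
next
  assume *: "(\<forall>n. (A ^^ n) x \<in> D) \<and> (\<exists>C. \<forall>n. norm ((A ^^ n) x) \<le> C * t ^ n)"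
  then obtain C where dom: "\<And>n. (A ^^ n) x \<in> D" and C: "\<And>n. norm ((A ^^ n) x) \<le> C * t ^ n"
    by blast
  have step: "norm ((A ^^ Suc m) x) \<le> t * norm ((A ^^ m) x)" for m
  proof -
    have shift: "(A ^^ n) ((A ^^ m) x) = (A ^^ (n + m)) x" for n by (simp add: funpow_add)
    have "norm (A ((A ^^ m) x)) \<le> t * norm ((A ^^ m) x)"
    proof (rule norm_A_le_of_growth[OF _ _ assms])
      show "norm ((A ^^ n) ((A ^^ m) x)) \<le> C * t ^ m * t ^ n" for n
        using C[of "n + m"] by (simp only: shift power_add mult_ac)
    qed (simp only: shift dom)
    then show ?thesis by simp
  qed
  have "norm ((A ^^ n) x) \<le> t ^ n * norm x" for n
  proof (induction n)
    case (Suc n)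
    have "norm ((A ^^ Suc n) x) \<le> t * (t ^ n * norm x)"
      using step[of n] mult_left_mono[OF Suc assms] by linarith
    then show ?case by simp
  qed simp
  with dom show "x \<in> F t" unfolding F_iff by blast
qed

text \<open>By this test an inclusion in \<open>F t\<close> needs a look at a single application of
  \<open>A\<close> instead of all its powers.\<close>

lemma F_maximal:
  assumes "M \<subseteq> D" "A ` M \<subseteq> M" "\<And>x. x \<in> M \<Longrightarrow> norm (A x) \<le> t * norm x" "t \<ge> 0"
  shows "M \<subseteq> F t"
proof
  fix x assume x: "x \<in> M"
  have "(A ^^ n) x \<in> M \<and> norm ((A ^^ n) x) \<le> t ^ n * norm x" for n
  proof (induction n)
    case (Suc n)
    then have "norm (A ((A ^^ n) x)) \<le> t * (t ^ n * norm x)"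
      using assms(3)[of "(A ^^ n) x"] mult_left_mono[of "norm ((A ^^ n) x)" _ t] assms(4)
      by (meson order_trans)
    then show ?case using assms(2) Suc by auto
  qed (simp add: x)
  then show "x \<in> F t" unfolding F_iff using assms(1) by blast
qed

lemma A_F: "A ` F t \<subseteq> F t"
proof (cases "t \<ge> 0")
  case True
  show ?thesis
  proof
    fix y assume "y \<in> A ` F t"
    then obtain x where x: "x \<in> F t" "y = A x" by blast
    then obtain C where *: "\<And>n. (A ^^ n) x \<in> D" "\<And>n. norm ((A ^^ n) x) \<le> C * t ^ n"
      unfolding F_iff_growth[OF True] by blast
    have "(A ^^ n) y = (A ^^ Suc n) x" for n
      by (simp add: x(2) funpow_swap1)
    then have "(A ^^ n) y \<in> D" "norm ((A ^^ n) y) \<le> (C * t) * t ^ n" for n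
      using *[of "Suc n"] by (auto simp: mult_ac)
    then show "y \<in> F t" unfolding F_iff_growth[OF True] by blast
  qed
next
  case False
  then show ?thesis by (simp add: F_neg zero)
qed

lemma subspace_F: "subspace (F t)"
proof (cases "t \<ge> 0")
  case True
  show ?thesis
  proof (rule subspaceI)
    fix x y r assume "x \<in> F t"
    then obtain C where x: "\<And>n. (A ^^ n) x \<in> D" "\<And>n. norm ((A ^^ n) x) \<le> C * t ^ n"
      unfolding F_iff_growth[OF True] by blast
    have "(A ^^ n) (r *\<^sub>R x) = r *\<^sub>R (A ^^ n) x" for n
      using x by (induction n) (auto simp: scale)
    moreover have "norm (r *\<^sub>R (A ^^ n) x) \<le> (\<bar>r\<bar> * C) * t ^ n" for n
      using mult_left_mono[OF x(2)[of n], of "\<bar>r\<bar>"] by (simp add: mult_ac)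
    ultimately show "r *\<^sub>R x \<in> F t"
      unfolding F_iff_growth[OF True] using x(1) subspace_scale[OF subspace_dom] by metis
    assume "y \<in> F t"
    then obtain C' where y: "\<And>n. (A ^^ n) y \<in> D" "\<And>n. norm ((A ^^ n) y) \<le> C' * t ^ n"
      unfolding F_iff_growth[OF True] by blast
    have "(A ^^ n) (x + y) = (A ^^ n) x + (A ^^ n) y" for n
      using x y by (induction n) (auto simp: add)
    moreover have "norm ((A ^^ n) x + (A ^^ n) y) \<le> (C + C') * t ^ n" for n
      using norm_triangle_ineq[of "(A ^^ n) x" "(A ^^ n) y"] x(2)[of n] y(2)[of n]
      by (simp add: distrib_right)
    ultimately show "x + y \<in> F t"
      unfolding F_iff_growth[OF True] using x(1) y(1) subspace_add[OF subspace_dom] by metis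
  qed (rule zero_in_F)
next
  case False
  then show ?thesis by (simp add: F_neg)
qed

text \<open>The closure of \<open>F t\<close> passes the test \<open>F_maximal\<close>: if
  \<open>X n\<close> in \<open>F t\<close> converges, the bound \<open>t\<close> makes
  \<open>A (X n)\<close> Cauchy, and the closed graph identifies its limit, which stays in the
  closure.\<close>

lemma closed_F: "closed (F t)"
proof (cases "t \<ge> 0")
  case True
  have lim: "x \<in> D \<and> A x \<in> closure (F t) \<and> norm (A x) \<le> t * norm x" if "x \<in> closure (F t)" for x
  proof -
    obtain X where X: "\<And>n::nat. X n \<in> F t" "X \<longlonglongrightarrow> x"
      using \<open>x \<in> closure (F t)\<close> unfolding closure_sequential by blast
    have "X n \<in> D" for n using X(1) F_subset_dom by blast
    then have "norm (A (X m) - A (X n)) \<le> t * norm (X m - X n)" for m n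
      using norm_A_F[OF subspace_diff[OF subspace_F X(1)[of m] X(1)[of n]]] by (simp add: diff)
    then have bound: "dist (A (X m)) (A (X n)) \<le> t * dist (X m) (X n)" for m n
      by (simp add: dist_norm)
    have "Cauchy (\<lambda>n. A (X n))"
    proof (rule metric_CauchyI)
      fix e :: real assume "0 < e"
      \<comment> \<open>Division by \<open>t + 1\<close> instead of \<open>t\<close> covers
        \<open>t = 0\<close>.\<close>
      then have "0 < e / (t + 1)" using True by simp
      then obtain N where N: "\<And>m n. N \<le> m \<Longrightarrow> N \<le> n \<Longrightarrow> dist (X m) (X n) < e / (t + 1)"
        using LIMSEQ_imp_Cauchy[OF X(2)] metric_CauchyD by blast
      have "dist (A (X m)) (A (X n)) < e" if "N \<le> m" "N \<le> n" for m n
      proof -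
        have "dist (A (X m)) (A (X n)) \<le> (t + 1) * dist (X m) (X n)"
          using bound[of m n] by (simp add: distrib_right add_increasing2)
        also have "\<dots> < e" using N[OF that] True by (simp add: pos_less_divide_eq mult.commute)
        finally show ?thesis .
      qed
      then show "\<exists>N. \<forall>m\<ge>N. \<forall>n\<ge>N. dist (A (X m)) (A (X n)) < e" by blast
    qed
    then obtain z where z: "(\<lambda>n. A (X n)) \<longlonglongrightarrow> z"
      using Cauchy_convergent convergent_def by blast
    then have "x \<in> D" "A x = z" using closed_graph[of X x z] X F_subset_dom by blast+
    moreover have "A (X n) \<in> F t" for n using X(1) A_F by blast
    then have "z \<in> closure (F t)" using z unfolding closure_sequential by (intro exI[of _ "\<lambda>n. A (X n)"] conjI allI)
    moreover have "norm z \<le> t * norm x"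
      using norm_A_F[OF X(1)] by (intro LIMSEQ_le[OF tendsto_norm[OF z] tendsto_mult_left[OF tendsto_norm[OF X(2)]]]) blast
    ultimately show ?thesis by blast
  qed
  have "closure (F t) \<subseteq> F t"
    by (rule F_maximal) (use lim True in blast)+
  then show ?thesis by (simp add: closure_subset_eq)
next
  case False
  then show ?thesis by (simp add: F_neg)
qed

lemma F_mono: "s \<le> t \<Longrightarrow> F s \<subseteq> F t"
proof (cases "s \<ge> 0")
  case True
  assume "s \<le> t"
  show ?thesis
  proof (rule F_maximal[OF F_subset_dom A_F])
    fix x assume "x \<in> F s"
    then show "norm (A x) \<le> t * norm x"
      using norm_A_F \<open>s \<le> t\<close> by (blast intro: order_trans mult_right_mono norm_ge_zero)
  qed (use True \<open>s \<le> t\<close> in simp)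
qed (simp add: F_neg zero_in_F)

text \<open>Let \<open>s\<close> decrease to \<open>t\<close> in \<open>s ^ n * norm x\<close>. This
  is the source of the right-continuity of \<open>E\<close>.\<close>

lemma F_right_continuous:
  assumes "\<And>s. s > t \<Longrightarrow> x \<in> F s"
  shows "x \<in> F t"
  unfolding F_iff
proof (intro allI conjI)
  fix n
  show "(A ^^ n) x \<in> D" using assms[of "t + 1"] unfolding F_iff by simp
  show "norm ((A ^^ n) x) \<le> t ^ n * norm x"
  proof (rule tendsto_lowerbound)
    show "((\<lambda>s. s ^ n * norm x) \<longlongrightarrow> t ^ n * norm x) (at_right t)"
      by (intro tendsto_intros)
    show "\<forall>\<^sub>F s in at_right t. norm ((A ^^ n) x) \<le> s ^ n * norm x"
      using assms unfolding F_iff eventually_at_right_field by (intro exI[of _ "t + 1"]) auto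
  qed simp
qed

end

section \<open>Reduction of \<open>A\<close> by \<open>F t\<close>, and the sign of
  \<open>t - A\<close> on the complement\<close>

context nonneg_self_adjoint
begin

text \<open>On \<open>F t\<close> the operator \<open>V\<close> is bounded, and bounded below by 1,
  so it is onto. Hence its inverse \<open>B\<close> leaves \<open>F t\<close> invariant, and being
  symmetric commutes with the projection.\<close>

lemma V_image_F: "V ` F t = F t"
proof (rule symmetric_surj_if_bounded_below)
  show "symmetric_operator (F t) V"
    using symmetric_operator.restrict[OF symmetric_V subspace_F F_subset_dom] .
  show "closed (F t)" by (rule closed_F)
  show "V ` F t \<subseteq> F t"
  proof (rule image_subsetI)
    fix x assume "x \<in> F t"
    moreover from this have "A x \<in> F t" using A_F by blast
    ultimately show "V x \<in> F t" unfolding V_def by (rule subspace_add[OF subspace_F])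
  qed
  fix x assume x: "x \<in> F t"
  then show "norm (V x) \<le> (1 + t) * norm x"
    using norm_A_F[OF x] norm_triangle_ineq[of x "A x"] by (simp add: V_def distrib_right)
  show "1 * norm x \<le> norm (V x)"
    using x F_subset_dom norm_le_V by auto
qed simp

lemma B_F: "y \<in> F t \<Longrightarrow> B y \<in> F t"
proof -
  assume "y \<in> F t"
  then have "y \<in> V ` F t" by (simp only: V_image_F)
  then obtain x where x: "x \<in> F t" "V x = y" by blast
  then have "B y = x" using F_subset_dom by (intro B_eqI) auto
  then show "B y \<in> F t" using x(1) by (simp only:)
qed

abbreviation E where "E t \<equiv> proj (F t)"

lemmas E_in = proj_in[OF subspace_F closed_F]
  and E_orth = proj_orth[OF subspace_F closed_F]
  and E_eqI = proj_eqI[OF subspace_F closed_F]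
  and E_diff = proj_diff[OF subspace_F closed_F]
  and norm_diff_E = norm_diff_proj[OF subspace_F closed_F]

lemma E_B: "E t (B x) = B (E t x)"
proof (rule E_eqI)
  show "B (E t x) \<in> F t" by (intro B_F E_in)
  fix z assume "z \<in> F t"
  then have "inner (x - E t x) (B z) = 0" by (intro E_orth B_F)
  then show "inner (B x - B (E t x)) z = 0"
    using B.symmetric[of "x - E t x" z] by (simp add: B.diff)
qed

lemma E_dom: "E t x \<in> D"
  using E_in F_subset_dom by blast

text \<open>Write \<open>x = B (V x)\<close>; the commutation with the bounded operator
  \<open>B\<close> then passes to \<open>A\<close>.\<close>

lemma A_E: "x \<in> D \<Longrightarrow> A (E t x) = E t (A x)"
proof -
  assume x: "x \<in> D"
  have "A (E t x) = A (B (E t (V x)))"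
    using E_B[of t "V x"] B_V[OF x] by simp
  also have "\<dots> = E t (V x) - E t (B (V x))"
    unfolding A_B E_B ..
  also have "\<dots> = E t (A x)"
    by (simp only: B_V[OF x] E_diff[symmetric]) (simp add: V_def)
  finally show ?thesis .
qed

text \<open>Formally \<open>C = B (t - A)\<close>, so the bounded operator \<open>C\<close> carries the sign of \<open>t - A\<close>.\<close>

context
  fixes t :: real
  assumes t: "t \<ge> 0"
begin

definition C where "C u = (1 + t) *\<^sub>R B u - u"

lemma symmetric_C: "symmetric_operator UNIV C"
  by unfold_locales
    (simp_all add: C_def B.add B.scale B.symmetric inner_diff_left inner_diff_right algebra_simps)

lemma norm_C: "norm (C u) \<le> (2 + t) * norm u"
proof -
  have "norm (C u) \<le> (1 + t) * norm (B u) + norm u"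
    unfolding C_def using t norm_triangle_ineq4[of "(1 + t) *\<^sub>R B u" u] by simp
  also have "\<dots> \<le> (1 + t) * norm u + norm u"
    using mult_left_mono[OF norm_B[of u], of "1 + t"] t by simp
  finally show ?thesis by (simp add: algebra_simps)
qed

lemma form_C_ge: "- (norm u)\<^sup>2 \<le> inner (C u) u"
proof -
  have "0 \<le> inner (B u) u" using form_B_ge[of u] zero_le_power2[of "norm (B u)"] by linarith
  then show ?thesis
    using t by (simp add: C_def inner_diff_left power2_norm_eq_inner)
qed

text \<open>Both \<open>(t - A) B = C\<close> and \<open>(1 + t) B = C + 1\<close>. The right-hand
  side is nonnegative where \<open>C >= 0\<close> and nonpositive where \<open>-1 <= C <= 0\<close>,
  so signs transfer from \<open>C\<close> to \<open>t - A\<close>.\<close>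

lemma form_t_minus_A:
  "(1 + t) * (t * (norm (B u))\<^sup>2 - inner (A (B u)) (B u)) = (norm (C u))\<^sup>2 + inner (C u) u"
proof -
  have Bu: "(1 + t) *\<^sub>R B u = C u + u" by (simp add: C_def)
  have "t *\<^sub>R B u - A (B u) = C u" by (simp add: A_B C_def algebra_simps)
  then have "t * (norm (B u))\<^sup>2 - inner (A (B u)) (B u) = inner (C u) (B u)"
    by (metis inner_diff_left inner_scaleR_left power2_norm_eq_inner)
  then have "(1 + t) * (t * (norm (B u))\<^sup>2 - inner (A (B u)) (B u)) = inner (C u) ((1 + t) *\<^sub>R B u)"
    by simp
  also have "\<dots> = (norm (C u))\<^sup>2 + inner (C u) u"
    unfolding Bu by (simp add: inner_add_right power2_norm_eq_inner)
  finally show ?thesis .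
qed

text \<open>On \<open>M\<close> one has \<open>(1 + t) B = C + 1 >= 1\<close>, so \<open>B\<close>
  maps \<open>M\<close> onto itself. Hence \<open>M\<close> lies in \<open>D\<close>, and
  \<open>A (B u) = u - B u\<close> makes it \<open>A\<close>-invariant. There
  \<open>0 <= A <= t\<close> as forms by \<open>form_t_minus_A\<close>, hence in norm, and
  \<open>F_maximal\<close> applies.\<close>

lemma subset_F_if_form_C_nonneg:
  assumes M: "subspace M" "closed M" "C ` M \<subseteq> M"
    and pos: "\<And>x. x \<in> M \<Longrightarrow> 0 \<le> inner (C x) x"
  shows "M \<subseteq> F t"
proof -
  have B_eq: "B u = (1 / (1 + t)) *\<^sub>R (C u + u)" for u
    using t by (simp add: C_def)
  have B_inv: "B ` M \<subseteq> M"
    using M by (auto simp: B_eq intro!: subspace_scale subspace_add)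
  have "B ` M = M"
  proof (rule symmetric_surj_if_bounded_below[OF B.restrict[OF M(1)] M(2) B_inv, of 1 "1 / (1 + t)"])
    fix x assume x: "x \<in> M"
    have "norm x * norm x \<le> inner (C x + x) x"
      using pos[OF x] by (simp add: inner_add_left power2_norm_eq_inner[symmetric] power2_eq_square)
    also have "\<dots> \<le> norm (C x + x) * norm x" by (rule norm_cauchy_schwarz)
    finally have "norm x \<le> norm (C x + x)" by (cases "x = 0") simp_all
    then show "1 / (1 + t) * norm x \<le> norm (B x)"
      using t by (simp add: B_eq divide_right_mono)
  qed (use norm_B t in auto)
  then have M_B: "\<exists>u\<in>M. y = B u" if "y \<in> M" for y using that by blast
  then have "M \<subseteq> D" using B_in by blast
  have A_inv: "A ` M \<subseteq> M"
  proof
    fix z assume "z \<in> A ` M"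
    then obtain y where y: "y \<in> M" "z = A y" by blast
    with M_B obtain u where "u \<in> M" "y = B u" by blast
    with y show "z \<in> M" using subspace_diff[OF M(1)] by (simp add: A_B)
  qed
  have "inner (A y) y \<le> t * (norm y)\<^sup>2" if y: "y \<in> M" for y
  proof -
    obtain u where u: "u \<in> M" "y = B u" using M_B[OF y] by blast
    have "0 \<le> (1 + t) * (t * (norm y)\<^sup>2 - inner (A y) y)"
      using form_t_minus_A[of u] pos[OF u(1)] u(2) by simp
    then show ?thesis using t by (simp add: zero_le_mult_iff)
  qed
  then have "norm (A y) \<le> t * norm y" if "y \<in> M" for y
    using symmetric_operator.norm_le_of_form_le[OF restrict[OF M(1) \<open>M \<subseteq> D\<close>] A_inv t]
      nonneg \<open>M \<subseteq> D\<close> that by blast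
  then show ?thesis using F_maximal[OF \<open>M \<subseteq> D\<close> A_inv] t by blast
qed

text \<open>The kernel of \<open>R - C\<close>, where \<open>R\<close> is the absolute value of \<open>C\<close>, lies in \<open>F(A, t)\<close>
  and contains the range of \<open>R + C\<close>. So \<open>C = - R\<close> on the orthogonal complement of \<open>F(A, t)\<close>.\<close>

lemma form_C_nonpos:
  assumes x: "\<And>z. z \<in> F t \<Longrightarrow> inner x z = 0"
  shows "inner (C x) x \<le> 0"
proof -
  interpret C: symmetric_operator UNIV C by (rule symmetric_C)
  obtain R where symR: "symmetric_operator UNIV R" and RR: "\<And>x. R (R x) = C (C x)"
    and RC: "\<And>x. R (C x) = C (R x)" and R_pos: "\<And>x. 0 \<le> inner (R x) x"
    using symmetric_abs_exists[OF symmetric_C norm_C] t by auto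
  interpret R: symmetric_operator UNIV R by fact
  \<comment> \<open>The kernel of \<open>R - C\<close>, written as the orthogonal complement of its
    range; in this form it is visibly closed.\<close>
  define M where "M = {y. \<forall>z. inner y (R z - C z) = 0}"
  have M_iff: "y \<in> M \<longleftrightarrow> R y = C y" for y
  proof -
    have "inner y (R z - C z) = inner (R y - C y) z" for z
      using R.symmetric[of y z] C.symmetric[of y z] by (simp add: inner_diff_left inner_diff_right)
    then have "y \<in> M \<longleftrightarrow> (\<forall>z. inner (R y - C y) z = 0)" by (simp only: M_def mem_Collect_eq)
    also have "\<dots> \<longleftrightarrow> R y - C y = 0"
      using inner_eq_zero_iff[of "R y - C y"] by (metis inner_zero_left)
    finally show ?thesis by simp
  qed
  have "M \<subseteq> F t"
  proof (rule subset_F_if_form_C_nonneg)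
    show "subspace M"
      by (rule subspaceI) (auto simp: M_iff R.add C.add R.scale C.scale R.zero C.zero)
    have "M = (\<Inter>z. {y. inner y (R z - C z) = 0})" by (auto simp: M_def)
    then show "closed M" by (simp add: closed_INT closed_Collect_eq continuous_on_inner)
    show "C ` M \<subseteq> M" by (auto simp: M_iff RC)
    show "0 \<le> inner (C y) y" if "y \<in> M" for y
      using that R_pos[of y] by (simp add: M_iff)
  qed
  \<comment> \<open>\<open>(R - C) (R + C) = R^2 - C^2 = 0\<close>, as \<open>R\<close> and
    \<open>C\<close> commute.\<close>
  moreover have "R z + C z \<in> M" for z
    by (simp add: M_iff R.add C.add RR RC)
  ultimately have "inner x (R z + C z) = 0" for z using x by blast
  then have "inner (R x + C x) z = 0" for z
    using R.symmetric[of x z] C.symmetric[of x z] by (simp add: inner_add_left inner_add_right)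
  then have "R x + C x = 0" using inner_eq_zero_iff by blast
  then have "C x = - R x" by (simp add: add_eq_0_iff)
  then show ?thesis using R_pos[of x] by simp
qed

text \<open>On the complement \<open>N\<close> of \<open>F t\<close> one has
  \<open>0 <= - C <= 1\<close>, so \<open>norm_square_le_form\<close> with \<open>K = 1\<close>
  gives \<open>C^2 + C <= 0\<close> there. Evaluated at \<open>V x\<close>, which lies in
  \<open>N\<close>, this is the claim by \<open>form_t_minus_A\<close>.\<close>

lemma form_A_ge_on_complement:
  assumes "x \<in> D" and x: "\<And>z. z \<in> F t \<Longrightarrow> inner x z = 0"
  shows "t * (norm x)\<^sup>2 \<le> inner (A x) x"
proof -
  define N where "N = {y. \<forall>z\<in>F t. inner y z = 0}"
  interpret C: symmetric_operator UNIV C by (rule symmetric_C)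
  have "subspace N"
    by (rule subspaceI) (auto simp: N_def inner_add_left)
  then interpret mC: symmetric_operator N "\<lambda>x. - C x"
    by unfold_locales (auto simp: C.add C.scale C.symmetric)
  have "C z \<in> F t" if "z \<in> F t" for z
    using that B_F by (simp add: C_def subspace_diff subspace_scale subspace_F)
  then have inv: "(\<lambda>x. - C x) ` N \<subseteq> N"
    by (auto simp: N_def C.symmetric)
  have pos: "0 \<le> inner (- C y) y" if "y \<in> N" for y
    using form_C_nonpos[of y] that by (auto simp: N_def)
  have le: "inner (- C y) y \<le> 1 * (norm y)\<^sup>2" for y
    using form_C_ge[of y] by simp
  have "V x \<in> N"
  proof -
    have "inner (V x) z = 0" if z: "z \<in> F t" for z
    proof -
      have "A z \<in> F t" "z \<in> D" using z A_F F_subset_dom by blast+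
      then show ?thesis
        using x[OF z] x[of "A z"] symmetric[OF \<open>x \<in> D\<close>, of z] by (simp add: V_def inner_add_left)
    qed
    then show ?thesis by (simp add: N_def)
  qed
  from mC.norm_square_le_form[OF inv _ pos le this]
  have "(norm (C (V x)))\<^sup>2 + inner (C (V x)) (V x) \<le> 0" by simp
  then have "(1 + t) * (t * (norm x)\<^sup>2 - inner (A x) x) \<le> 0"
    using form_t_minus_A[of "V x"] B_V[OF \<open>x \<in> D\<close>] by simp
  then show ?thesis using t by (simp add: mult_le_0_iff)
qed

end

end

subsection \<open>Stieltjes integrals\<close>

text \<open>Over \<open>n + 1\<close> equal pieces the increments of \<open>G\<close> telescope, so
  the total change of \<open>f\<close> is at most
  \<open>L * (b - a) * (G b - G a) / (n + 1)\<close>.\<close>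

lemma eq_if_increments_small:
  fixes f G :: "real \<Rightarrow> real"
  assumes "a \<le> b"
    and incr: "\<And>s t. a \<le> s \<Longrightarrow> s \<le> t \<Longrightarrow> t \<le> b \<Longrightarrow> \<bar>f t - f s\<bar> \<le> L * (t - s) * (G t - G s)"
  shows "f b = f a"
proof -
  have bound: "\<bar>f b - f a\<bar> \<le> L * (b - a) * (G b - G a) * inverse (real (Suc n))" for n
  proof -
    define h where "h = (b - a) / real (Suc n)"
    define x where "x i = a + real i * h" for i
    have h: "h \<ge> 0" using \<open>a \<le> b\<close> by (simp add: h_def)
    have ends: "x 0 = a" "x (Suc n) = b" by (simp_all add: x_def h_def)
    have "f b - f a = (\<Sum>i<Suc n. f (x (Suc i)) - f (x i))"
      using sum_lessThan_telescope[of "\<lambda>i. f (x i)" "Suc n"] by (simp only: ends)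
    also have "\<bar>\<dots>\<bar> \<le> (\<Sum>i<Suc n. \<bar>f (x (Suc i)) - f (x i)\<bar>)" by (rule sum_abs)
    also have "\<dots> \<le> (\<Sum>i<Suc n. L * h * (G (x (Suc i)) - G (x i)))"
    proof (rule sum_mono)
      fix i assume "i \<in> {..<Suc n}"
      then have "real (Suc i) * h \<le> real (Suc n) * h" using h by (intro mult_right_mono) auto
      then have "x (Suc i) \<le> b" by (simp add: x_def h_def)
      moreover have "a \<le> x i" "x i \<le> x (Suc i)" "x (Suc i) - x i = h"
        using h by (simp_all add: x_def algebra_simps)
      ultimately show "\<bar>f (x (Suc i)) - f (x i)\<bar> \<le> L * h * (G (x (Suc i)) - G (x i))"
        using incr[of "x i" "x (Suc i)"] by simp
    qed
    also have "\<dots> = L * h * (G b - G a)"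
      using sum_lessThan_telescope[of "\<lambda>i. G (x i)" "Suc n"]
      by (simp only: sum_distrib_left[symmetric] ends)
    finally show ?thesis by (simp add: h_def field_simps)
  qed
  have "(\<lambda>n. L * (b - a) * (G b - G a) * inverse (real (Suc n))) \<longlonglongrightarrow> 0"
    by (intro tendsto_mult_right_zero LIMSEQ_inverse_real_of_nat)
  then have "\<bar>f b - f a\<bar> \<le> 0"
    by (rule LIMSEQ_le_const) (use bound in blast)
  then show ?thesis by simp
qed

text \<open>The integral \<open>J t\<close> over \<open>{a<..t}\<close> obeys the same two bounds as
  \<open>H\<close>. So the increments of \<open>H - J\<close> are at most
  \<open>(\<psi> t - \<psi> s) * (G t - G s)\<close>, and the Lipschitz bound makes
  \<open>eq_if_increments_small\<close> applicable.\<close>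

lemma interval_measure_integral_eqI:
  fixes G H \<psi> :: "real \<Rightarrow> real"
  assumes G: "\<And>s t. s \<le> t \<Longrightarrow> G s \<le> G t" "\<And>t. continuous (at_right t) G"
    and "mono \<psi>" and "a \<le> b"
    and lipschitz: "\<And>s t. a \<le> s \<Longrightarrow> s \<le> t \<Longrightarrow> t \<le> b \<Longrightarrow> \<psi> t - \<psi> s \<le> L * (t - s)"
    and lower: "\<And>s t. a \<le> s \<Longrightarrow> s \<le> t \<Longrightarrow> t \<le> b \<Longrightarrow> \<psi> s * (G t - G s) \<le> H t - H s"
    and upper: "\<And>s t. a \<le> s \<Longrightarrow> s \<le> t \<Longrightarrow> t \<le> b \<Longrightarrow> H t - H s \<le> \<psi> t * (G t - G s)"
  shows "integrable (interval_measure G) (\<lambda>t. indicator {a<..b} t * \<psi> t)"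
    and "(\<integral>t. indicator {a<..b} t * \<psi> t \<partial>interval_measure G) = H b - H a"
proof -
  let ?M = "interval_measure G"
  have meas: "\<psi> \<in> borel_measurable ?M"
    using borel_measurable_mono[OF \<open>mono \<psi>\<close>] by simp
  have fin: "emeasure ?M {s<..t} < \<infinity>" for s t
    by (simp add: emeasure_interval_measure_Ioc_eq[OF G])
  have int: "integrable ?M (\<lambda>u. indicator {s<..t} u * \<psi> u)" for s t
  proof -
    have "\<bar>\<psi> u\<bar> \<le> max \<bar>\<psi> s\<bar> \<bar>\<psi> t\<bar>" if "u \<in> {s<..t}" for u
      using monoD[OF \<open>mono \<psi>\<close>, of s u] monoD[OF \<open>mono \<psi>\<close>, of u t] that by auto
    then show ?thesis
      using integrableI_bounded_set_indicator[of "{s<..t}" ?M \<psi> "max \<bar>\<psi> s\<bar> \<bar>\<psi> t\<bar>"] meas fin[of s t]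
      by auto
  qed
  show "integrable ?M (\<lambda>t. indicator {a<..b} t * \<psi> t)" by (rule int)
  define J where "J t = (\<integral>u. indicator {a<..t} u * \<psi> u \<partial>?M)" for t
  have const: "(\<integral>u. indicator {s<..t} u * c \<partial>?M) = c * (G t - G s)" if "s \<le> t" for s t c
    using that by (simp add: measure_interval_measure_Ioc[OF _ G])
  have const_int: "integrable ?M (\<lambda>u. indicator {s<..t} u * c)" for s t and c :: real
    using integrable_indicator[of "{s<..t}" ?M] fin[of s t] by simp
  have J_diff: "J t - J s = (\<integral>u. indicator {s<..t} u * \<psi> u \<partial>?M)" if "a \<le> s" "s \<le> t" for s t
    unfolding J_def Bochner_Integration.integral_diff[OF int int, symmetric]
    by (rule Bochner_Integration.integral_cong) (use that in \<open>auto simp: indicator_def\<close>)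
  have J_lower: "\<psi> s * (G t - G s) \<le> J t - J s" if "a \<le> s" "s \<le> t" for s t
    unfolding J_diff[OF that] const[OF \<open>s \<le> t\<close>, symmetric]
    by (rule integral_mono[OF const_int int]) (auto simp: indicator_def intro: monoD[OF \<open>mono \<psi>\<close>])
  have J_upper: "J t - J s \<le> \<psi> t * (G t - G s)" if "a \<le> s" "s \<le> t" for s t
    unfolding J_diff[OF that] const[OF \<open>s \<le> t\<close>, symmetric]
    by (rule integral_mono[OF int const_int]) (auto simp: indicator_def intro: monoD[OF \<open>mono \<psi>\<close>])
  have "H b - J b = H a - J a"
  proof (rule eq_if_increments_small[OF \<open>a \<le> b\<close>, where L = L and G = G])
    fix s t assume st: "a \<le> s" "s \<le> t" "t \<le> b"
    have "\<bar>(H t - J t) - (H s - J s)\<bar> \<le> (\<psi> t - \<psi> s) * (G t - G s)"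
      using lower[OF st] upper[OF st] J_lower[OF st(1,2)] J_upper[OF st(1,2)]
      by (simp add: left_diff_distrib)
    also have "\<dots> \<le> L * (t - s) * (G t - G s)"
      using lipschitz[OF st] G(1)[OF st(2)] by (intro mult_right_mono) auto
    finally show "\<bar>(H t - J t) - (H s - J s)\<bar> \<le> L * (t - s) * (G t - G s)" .
  qed
  moreover have "J a = 0" by (simp add: J_def)
  ultimately show "(\<integral>t. indicator {a<..b} t * \<psi> t \<partial>?M) = H b - H a"
    by (simp add: J_def)
qed

text \<open>Meant for orthogonal increments, with \<open>a n\<close> the squared norm of
  \<open>X n\<close>.\<close>

lemma Cauchy_if_norm_square_le:
  fixes X :: "nat \<Rightarrow> 'a::real_normed_vector"
  assumes "Cauchy a" and le: "\<And>m n. m \<le> n \<Longrightarrow> (norm (X n - X m))\<^sup>2 \<le> \<bar>a n - a m :: real\<bar>"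
  shows "Cauchy X"
proof (rule CauchyI')
  fix e :: real assume "0 < e"
  then have "0 < e\<^sup>2" by simp
  from CauchyD[OF \<open>Cauchy a\<close> this] obtain N where
    N: "\<And>m n. N \<le> m \<Longrightarrow> N \<le> n \<Longrightarrow> \<bar>a m - a n\<bar> < e\<^sup>2" by auto
  have "dist (X m) (X n) < e" if "N \<le> m" "m < n" for m n
  proof -
    have "(norm (X n - X m))\<^sup>2 < e\<^sup>2" using le[of m n] N[of n m] that by simp
    then have "norm (X n - X m) < e" by (rule power_less_imp_less_base) (use \<open>0 < e\<close> in simp)
    then show ?thesis by (simp add: dist_norm norm_minus_commute)
  qed
  then show "\<exists>N. \<forall>m\<ge>N. \<forall>n>m. dist (X m) (X n) < e" by blast
qed

subsection \<open>The spectral family\<close>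

context nonneg_self_adjoint
begin

lemma E_E: "s \<le> t \<Longrightarrow> E s (E t x) = E s x"
  by (rule proj_proj_subset[OF subspace_F closed_F subspace_F closed_F F_mono])

lemma norm_E_increment: "s \<le> t \<Longrightarrow> (norm (E t x - E s x))\<^sup>2 = (norm (E t x))\<^sup>2 - (norm (E s x))\<^sup>2"
  using norm_diff_E[of "E t x" s] by (simp add: E_E)

lemma norm_E_mono: "s \<le> t \<Longrightarrow> (norm (E s x))\<^sup>2 \<le> (norm (E t x))\<^sup>2"
  using norm_E_increment[of s t x] zero_le_power2[of "norm (E t x - E s x)"] by linarith

lemma E_neg: "t < 0 \<Longrightarrow> E t x = 0"
  using E_in[of t x] F_neg by blast

text \<open>Along \<open>s n\<close> the squared norms decrease, so \<open>E (s n) x\<close>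
  converges to some \<open>y\<close>. It lies in every \<open>F r\<close> with \<open>r > t\<close>,
  hence in \<open>F t\<close>, and \<open>x - y\<close> is orthogonal to \<open>F t\<close>; so
  \<open>y = E t x\<close>. Monotonicity of the norms extends the limit from the sequence to all
  \<open>r > t\<close>.\<close>

lemma E_right_limit: "((\<lambda>s. E s x) \<longlongrightarrow> E t x) (at_right t)"
proof -
  define s where "s n = t + inverse (real (Suc n))" for n
  have s_gt: "t < s n" for n by (simp add: s_def)
  have s_antimono: "s n \<le> s m" if "m \<le> n" for m n
    using that by (auto simp: s_def intro!: le_imp_inverse_le)
  have s_lim: "s \<longlonglongrightarrow> t"
    using tendsto_add[OF tendsto_const[of t] LIMSEQ_inverse_real_of_nat] by (simp add: s_def[abs_def])
  have "Cauchy (\<lambda>n. E (s n) x)"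
  proof (rule Cauchy_if_norm_square_le)
    have "decseq (\<lambda>n. (norm (E (s n) x))\<^sup>2)"
      using norm_E_mono s_antimono by (auto simp: decseq_def)
    then show "Cauchy (\<lambda>n. (norm (E (s n) x))\<^sup>2)"
      by (rule decseq_convergent[of _ 0]) (auto intro: LIMSEQ_imp_Cauchy)
    fix m n :: nat assume "m \<le> n"
    then show "(norm (E (s n) x - E (s m) x))\<^sup>2 \<le> \<bar>(norm (E (s n) x))\<^sup>2 - (norm (E (s m) x))\<^sup>2\<bar>"
      using norm_E_increment[OF s_antimono, of m n x] by (simp add: norm_minus_commute)
  qed
  then obtain y where y: "(\<lambda>n. E (s n) x) \<longlonglongrightarrow> y"
    using Cauchy_convergent convergent_def by blast
  have "y \<in> F t"
  proof (rule F_right_continuous)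
    fix r assume "t < r"
    then have "eventually (\<lambda>n. s n < r) sequentially" using s_lim by (simp add: order_tendstoD)
    then have "\<forall>\<^sub>F n in sequentially. E (s n) x \<in> F r"
      by eventually_elim (use E_in F_mono in \<open>blast intro: less_imp_le\<close>)
    then show "y \<in> F r" using Lim_in_closed_set[OF closed_F _ _ y] by simp
  qed
  moreover have "inner (x - y) z = 0" if "z \<in> F t" for z
  proof -
    have "(\<lambda>n. inner (x - E (s n) x) z) \<longlonglongrightarrow> inner (x - y) z"
      by (intro tendsto_intros y)
    moreover have "inner (x - E (s n) x) z = 0" for n
      using that F_mono[of t "s n"] s_gt[of n] E_orth by (simp add: subset_eq)
    ultimately show ?thesis by (simp add: LIMSEQ_const_iff)
  qed
  ultimately have "E t x = y" by (rule E_eqI)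
  with y have lim: "(\<lambda>n. E (s n) x) \<longlonglongrightarrow> E t x" by simp
  show ?thesis
  proof (rule tendstoI)
    fix e :: real assume "0 < e"
    with tendstoD[OF lim] have "\<forall>\<^sub>F n in sequentially. dist (E (s n) x) (E t x) < e" by blast
    then obtain n where n: "dist (E (s n) x) (E t x) < e"
      by (auto dest: eventually_happens)
    have "dist (E r x) (E t x) < e" if "t < r" "r < s n" for r
    proof -
      have "(norm (E r x - E t x))\<^sup>2 \<le> (norm (E (s n) x - E t x))\<^sup>2"
        using that s_gt[of n] norm_E_mono[of r "s n" x] by (simp add: norm_E_increment)
      then have "norm (E r x - E t x) \<le> norm (E (s n) x - E t x)" by (rule power2_le_imp_le) simp
      with n show ?thesis by (simp add: dist_norm)
    qed
    then show "\<forall>\<^sub>F r in at_right t. dist (E r x) (E t x) < e"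
      unfolding eventually_at_right_field using s_gt by blast
  qed
qed

lemma form_A_ge:
  assumes "x \<in> D" "E t x = 0" "t \<ge> 0"
  shows "t * (norm x)\<^sup>2 \<le> inner (A x) x"
  using assms E_orth[of _ t x] by (intro form_A_ge_on_complement) auto

lemma norm_A_ge:
  assumes "x \<in> D" "E t x = 0" "t \<ge> 0"
  shows "t * norm x \<le> norm (A x)"
proof -
  have "t * norm x * norm x \<le> norm (A x) * norm x"
    using form_A_ge[OF assms] norm_cauchy_schwarz[of "A x" x] by (simp add: power2_eq_square)
  then show ?thesis by (cases "x = 0") simp_all
qed

lemma E_diff_self: "E t (x - E t x) = 0"
  by (simp add: E_diff E_E)

lemma norm_diff_E_le_norm: "norm (x - E t x) \<le> norm x"
  by (rule power2_le_imp_le) (simp_all add: norm_diff_E)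

lemma norm_diff_E_le:
  assumes "x \<in> D" "t > 0"
  shows "norm (x - E t x) \<le> norm (A x) / t"
proof -
  have "t * norm (x - E t x) \<le> norm (A (x - E t x))"
    using assms E_dom subspace_dom by (intro norm_A_ge E_diff_self subspace_diff) auto
  also have "A (x - E t x) = A x - E t (A x)"
    using assms E_dom by (simp add: diff A_E)
  also have "norm \<dots> \<le> norm (A x)"
    by (rule norm_diff_E_le_norm)
  finally show ?thesis using assms by (simp add: pos_le_divide_eq mult.commute)
qed

text \<open>On \<open>D\<close> the error is at most \<open>norm (A d) / t\<close>, because
  \<open>A >= t\<close> off \<open>F t\<close>. Density of \<open>D\<close> and the contractivity of
  \<open>1 - E t\<close> give the rest.\<close>

lemma E_at_top: "((\<lambda>t. E t x) \<longlongrightarrow> x) at_top"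
proof (rule tendstoI)
  fix e :: real assume "0 < e"
  then obtain d where d: "d \<in> D" "dist d x < e / 2"
    using dense closure_approachable[of x D] by (metis UNIV_I half_gt_zero)
  have "((\<lambda>t. norm (A d) / t) \<longlongrightarrow> 0) at_top"
    by (intro tendsto_divide_0[OF tendsto_const] filterlim_at_top_imp_at_infinity filterlim_ident)
  then have "\<forall>\<^sub>F t in at_top. norm (A d) / t < e / 2"
    using \<open>0 < e\<close> by (intro order_tendstoD) auto
  moreover have "\<forall>\<^sub>F t :: real in at_top. 0 < t" by (rule eventually_gt_at_top)
  ultimately show "\<forall>\<^sub>F t in at_top. dist (E t x) x < e"
  proof eventually_elim
    case (elim t)
    have "x - E t x = ((x - d) - E t (x - d)) + (d - E t d)" by (simp add: E_diff)
    then have "norm (x - E t x) \<le> norm ((x - d) - E t (x - d)) + norm (d - E t d)"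
      by (metis norm_triangle_ineq)
    also have "\<dots> < e"
      using norm_diff_E_le_norm[of "x - d" t] norm_diff_E_le[OF d(1) elim(2)] elim(1) d(2)
      unfolding dist_norm norm_minus_commute[of d x] by linarith
    finally show ?case by (simp add: dist_norm norm_minus_commute)
  qed
qed

lemma E_at_bot: "((\<lambda>t. E t x) \<longlongrightarrow> 0) at_bot"
proof (rule tendsto_eventually)
  show "\<forall>\<^sub>F t in at_bot. E t x = 0"
    using eventually_gt_at_bot[of 0] by (rule eventually_mono) (simp add: E_neg)
qed

text \<open>The cross terms vanish: \<open>A (E s x)\<close> stays in \<open>F s\<close>, to which
  \<open>E t x - E s x\<close> is orthogonal.\<close>

lemma form_A_E_increment:
  assumes "s \<le> t"
  shows "inner (A (E t x - E s x)) (E t x - E s x)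
    = inner (A (E t x)) (E t x) - inner (A (E s x)) (E s x)"
proof -
  let ?w = "E t x" and ?v = "E s x"
  have "A ?v \<in> F s" using A_F E_in by blast
  then have orth: "inner (?w - ?v) (A ?v) = 0"
    using E_orth[of "A ?v" s ?w] assms by (simp add: E_E)
  have "inner (A (?w - ?v)) (?w - ?v) = inner (A ?w) ?w - inner (A ?v) ?v - 2 * inner (?w - ?v) (A ?v)"
    using symmetric[OF E_dom[of t x] E_dom[of s x]]
    by (simp add: diff E_dom inner_diff_left inner_diff_right inner_commute[of "A ?v"])
  then show ?thesis using orth by simp
qed

text \<open>As \<open>A\<close> commutes with \<open>E s\<close>, this is Pythagoras for
  \<open>A (E t x)\<close>.\<close>

lemma norm_A_E_increment:
  assumes "s \<le> t"
  shows "(norm (A (E t x - E s x)))\<^sup>2 = (norm (A (E t x)))\<^sup>2 - (norm (A (E s x)))\<^sup>2"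
  using norm_diff_E[of "A (E t x)" s] assms by (simp add: diff E_dom A_E[symmetric] E_E)

text \<open>Here \<open>y\<close> lies in \<open>F t\<close> and \<open>E s y = 0\<close>. The
  cutoff at 0 costs nothing: a negative \<open>s\<close> gives only \<open>A >= 0\<close>, and
  \<open>F t\<close> is contained in \<open>F (max t 0)\<close>. It keeps the weights nonnegative
  and monotone, also when squared.\<close>

lemma
  fixes x
  assumes "s \<le> t"
  defines "y \<equiv> E t x - E s x"
  shows norm_A_E_increment_le: "norm (A y) \<le> max t 0 * norm y"
    and norm_A_E_increment_ge: "max s 0 * norm y \<le> norm (A y)"
    and form_A_E_increment_le: "inner (A y) y \<le> max t 0 * (norm y)\<^sup>2"
    and form_A_E_increment_ge: "max s 0 * (norm y)\<^sup>2 \<le> inner (A y) y"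
proof -
  have y: "y \<in> D" unfolding y_def using E_dom subspace_dom by (intro subspace_diff) auto
  have "E s x \<in> F t" using E_in F_mono[OF assms(1)] by blast
  then have "y \<in> F t" unfolding y_def using E_in subspace_F by (intro subspace_diff)
  then have "y \<in> F (max t 0)" using F_mono[of t "max t 0"] by auto
  then show le: "norm (A y) \<le> max t 0 * norm y" by (rule norm_A_F)
  show "inner (A y) y \<le> max t 0 * (norm y)\<^sup>2"
    using norm_cauchy_schwarz[of "A y" y] mult_right_mono[OF le, of "norm y"]
    by (simp add: power2_eq_square mult.assoc)
  have "E s y = 0" unfolding y_def using assms(1) by (simp add: E_diff E_E)
  then show "max s 0 * norm y \<le> norm (A y)" "max s 0 * (norm y)\<^sup>2 \<le> inner (A y) y"
    using norm_A_ge[OF y, of s] form_A_ge[OF y, of s] nonneg[OF y] by (cases "s \<ge> 0"; simp)+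
qed

subsection \<open>The spectral integral\<close>

abbreviation spec where "spec x \<equiv> interval_measure (\<lambda>t. (norm (E t x))\<^sup>2)"

lemma continuous_norm_E: "continuous (at_right t) (\<lambda>s. (norm (E s x))\<^sup>2)"
  unfolding continuous_within by (intro tendsto_intros E_right_limit)

text \<open>The intervals stop short of 0, where \<open>E\<close> jumps if \<open>A\<close> has a
  kernel.\<close>

lemma AE_spec_nonneg: "AE t in spec x. 0 \<le> t"
proof -
  have "(\<Union>n. {- real (Suc n) <.. - inverse (real (Suc n))}) \<in> null_sets (spec x)"
  proof (rule null_sets_UN)
    fix n
    have "emeasure (spec x) {- real (Suc n) <.. - inverse (real (Suc n))} = 0"
      using E_neg[of "- real (Suc n)"] E_neg[of "- inverse (real (Suc n))"]
      by (subst emeasure_interval_measure_Ioc_eq[OF norm_E_mono continuous_norm_E]) simp_all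
    then show "{- real (Suc n) <.. - inverse (real (Suc n))} \<in> null_sets (spec x)" by (simp add: null_sets_def)
  qed
  moreover have "{t \<in> space (spec x). \<not> 0 \<le> t} \<subseteq> (\<Union>n. {- real (Suc n) <.. - inverse (real (Suc n))})"
  proof
    fix t assume "t \<in> {t \<in> space (spec x). \<not> 0 \<le> t}"
    then have "t < 0" by simp
    obtain m where m: "- t < real m" using reals_Archimedean2 by blast
    obtain k where k: "inverse (real (Suc k)) < - t" using reals_Archimedean[of "- t"] \<open>t < 0\<close> by auto
    have "- real (Suc (max m k)) < t" using m by simp
    moreover have "inverse (real (Suc (max m k))) \<le> inverse (real (Suc k))"
      by (intro le_imp_inverse_le) auto
    then have "t \<le> - inverse (real (Suc (max m k)))" using k by linarith
    ultimately have "t \<in> {- real (Suc (max m k)) <.. - inverse (real (Suc (max m k)))}" by simp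
    then show "t \<in> (\<Union>n. {- real (Suc n) <.. - inverse (real (Suc n))})" by blast
  qed
  ultimately show ?thesis by (rule AE_I')
qed

text \<open>\<open>p = 1\<close> serves the form of \<open>A\<close> and \<open>p = 2\<close> the
  squared norm. The lower end -1 lies left of the support, so \<open>H\<close> vanishes there and a
  possible atom at 0 is included.\<close>

lemma spec_integral_truncated:
  fixes p :: nat
  assumes p: "p = 1 \<or> p = 2"
    and H0: "H (-1) = 0"
    and lower: "\<And>s t. s \<le> t \<Longrightarrow> (max s 0) ^ p * (norm (E t x - E s x))\<^sup>2 \<le> H t - H s"
    and upper: "\<And>s t. s \<le> t \<Longrightarrow> H t - H s \<le> (max t 0) ^ p * (norm (E t x - E s x))\<^sup>2"
  shows "integrable (spec x) (\<lambda>t. indicator {-1<..real n} t * (max t 0) ^ p)"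
    and "(\<integral>t. indicator {-1<..real n} t * (max t 0) ^ p \<partial>spec x) = H (real n)"
proof -
  \<comment> \<open>One constant for both exponents: 1 suffices for \<open>p = 1\<close>, and
    \<open>max t 0 + max s 0 <= 2 * real n\<close> for \<open>p = 2\<close>.\<close>
  have lipschitz: "(max t 0) ^ p - (max s 0) ^ p \<le> (1 + 2 * real n) * (t - s)"
    if st: "s \<le> t" "t \<le> real n" for s t
  proof -
    have d: "0 \<le> max t 0 - max s 0" "max t 0 - max s 0 \<le> t - s" using st by auto
    show ?thesis
      using p
    proof
      assume "p = 1"
      have "1 * (t - s) \<le> (1 + 2 * real n) * (t - s)" using st by (intro mult_right_mono) auto
      with \<open>p = 1\<close> d show ?thesis by simp
    next
      assume "p = 2"
      have "(max t 0)\<^sup>2 - (max s 0)\<^sup>2 = (max t 0 + max s 0) * (max t 0 - max s 0)"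
        by (simp add: power2_eq_square algebra_simps)
      also have "\<dots> \<le> (1 + 2 * real n) * (t - s)" using st d by (intro mult_mono) auto
      finally show ?thesis using \<open>p = 2\<close> by simp
    qed
  qed
  have mono: "mono (\<lambda>t::real. (max t 0) ^ p)"
    by (intro monoI power_mono) auto
  have "(max s 0) ^ p * ((norm (E t x))\<^sup>2 - (norm (E s x))\<^sup>2) \<le> H t - H s"
    and "H t - H s \<le> (max t 0) ^ p * ((norm (E t x))\<^sup>2 - (norm (E s x))\<^sup>2)" if "s \<le> t" for s t
    using lower[OF that] upper[OF that] that by (simp_all add: norm_E_increment)
  note * = norm_E_mono continuous_norm_E mono lipschitz this
  show "integrable (spec x) (\<lambda>t. indicator {-1<..real n} t * (max t 0) ^ p)"
    by (rule interval_measure_integral_eqI[where H = H]; (rule *)?; simp)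
  have "(\<integral>t. indicator {-1<..real n} t * (max t 0) ^ p \<partial>spec x) = H (real n) - H (-1)"
    by (rule interval_measure_integral_eqI; (rule *)?; simp)
  then show "(\<integral>t. indicator {-1<..real n} t * (max t 0) ^ p \<partial>spec x) = H (real n)"
    by (simp add: H0)
qed

text \<open>Monotone convergence; almost everywhere \<open>t >= 0\<close>, so the cutoff disappears
  in the limit.\<close>

lemma spec_integral_limit:
  fixes p :: nat
  assumes p: "p = 1 \<or> p = 2"
    and int: "\<And>n. integrable (spec x) (\<lambda>t. indicator {-1<..real n} t * (max t 0) ^ p)"
    and lim: "(\<lambda>n. \<integral>t. indicator {-1<..real n} t * (max t 0) ^ p \<partial>spec x) \<longlonglongrightarrow> l"
  shows "integrable (spec x) (\<lambda>t. t ^ p)" and "(\<integral>t. t ^ p \<partial>spec x) = l"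
proof -
  have mono: "AE t in spec x. mono (\<lambda>n. indicator {-1<..real n} t * (max t 0) ^ p)"
    by (intro AE_I2 monoI) (auto simp: indicator_def)
  have pos: "AE t in spec x. 0 \<le> indicator {-1<..real n} t * (max t 0) ^ p" for n
    by (intro AE_I2) auto
  have pointwise: "AE t in spec x. (\<lambda>n. indicator {-1<..real n} t * (max t 0) ^ p) \<longlonglongrightarrow> t ^ p"
    using AE_spec_nonneg
  proof eventually_elim
    case (elim t)
    obtain m where "t \<le> real m" using real_arch_simple by blast
    then have "\<forall>\<^sub>F n in sequentially. indicator {-1<..real n} t * (max t 0) ^ p = t ^ p"
      using elim by (intro eventually_sequentiallyI[of m]) (auto simp: indicator_def)
    then show ?case by (rule tendsto_eventually)
  qed
  have meas: "(\<lambda>t. t ^ p) \<in> borel_measurable (spec x)" by measurable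
  show "integrable (spec x) (\<lambda>t. t ^ p)" "(\<integral>t. t ^ p \<partial>spec x) = l"
    by (rule integral_monotone_convergence_nonneg[OF int mono pos pointwise lim meas])+
qed

lemma
  shows integrable_spec_form_truncated:
      "integrable (spec x) (\<lambda>t. indicator {-1<..real n} t * (max t 0) ^ 1)"
    and integral_spec_form_truncated:
      "(\<integral>t. indicator {-1<..real n} t * (max t 0) ^ 1 \<partial>spec x) = inner (A (E (real n) x)) (E (real n) x)"
  by (rule spec_integral_truncated[where H = "\<lambda>t. inner (A (E t x)) (E t x)"];
      simp add: E_neg form_A_E_increment[symmetric] form_A_E_increment_le form_A_E_increment_ge)+

lemma
  shows integrable_spec_norm_truncated:
      "integrable (spec x) (\<lambda>t. indicator {-1<..real n} t * (max t 0) ^ 2)"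
    and integral_spec_norm_truncated:
      "(\<integral>t. indicator {-1<..real n} t * (max t 0) ^ 2 \<partial>spec x) = (norm (A (E (real n) x)))\<^sup>2"
  by (rule spec_integral_truncated[where H = "\<lambda>t. (norm (A (E t x)))\<^sup>2"];
      simp add: E_neg zero norm_A_E_increment[symmetric] power_mult_distrib[symmetric] power_mono
        norm_A_E_increment_le norm_A_E_increment_ge)+

lemma E_real_tendsto: "(\<lambda>n. E (real n) x) \<longlonglongrightarrow> x"
  using filterlim_compose[OF E_at_top filterlim_real_sequentially] .

lemma A_E_real_tendsto: "x \<in> D \<Longrightarrow> (\<lambda>n. A (E (real n) x)) \<longlonglongrightarrow> A x"
  using E_real_tendsto[of "A x"] by (simp add: A_E)

lemma
  assumes "x \<in> D"
  shows integrable_spec_form: "integrable (spec x) (\<lambda>t. t)"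
    and integral_spec_form: "(\<integral>t. t \<partial>spec x) = inner (A x) x"
proof -
  have "(\<lambda>n. inner (A (E (real n) x)) (E (real n) x)) \<longlonglongrightarrow> inner (A x) x"
    by (intro tendsto_inner A_E_real_tendsto E_real_tendsto assms)
  from spec_integral_limit[OF _ integrable_spec_form_truncated this[folded integral_spec_form_truncated]]
  show "integrable (spec x) (\<lambda>t. t)" "(\<integral>t. t \<partial>spec x) = inner (A x) x" by simp_all
qed

lemma nn_integral_spec_norm:
  assumes "x \<in> D"
  shows "(\<integral>\<^sup>+ t. ennreal (t\<^sup>2) \<partial>spec x) = ennreal ((norm (A x))\<^sup>2)"
proof -
  have "(\<lambda>n. (norm (A (E (real n) x)))\<^sup>2) \<longlonglongrightarrow> (norm (A x))\<^sup>2"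
    by (intro tendsto_intros A_E_real_tendsto assms)
  from spec_integral_limit[OF _ integrable_spec_norm_truncated this[folded integral_spec_norm_truncated]]
  show ?thesis by (simp add: nn_integral_eq_integral)
qed

text \<open>The squared norms of \<open>A (E (real n) x)\<close> increase and are bounded by the
  integral. By orthogonality of the increments these vectors are Cauchy, and the closed graph puts
  \<open>x\<close> into \<open>D\<close>.\<close>

lemma in_dom_if_nn_integral_finite:
  assumes "(\<integral>\<^sup>+ t. ennreal (t\<^sup>2) \<partial>spec x) < \<infinity>"
  shows "x \<in> D"
proof -
  have int: "integrable (spec x) (\<lambda>t. t\<^sup>2)"
    using assms by (intro integrableI_nonneg) auto
  define a where "a n = (norm (A (E (real n) x)))\<^sup>2" for n
  have "a n \<le> (\<integral>t. t\<^sup>2 \<partial>spec x)" for n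
    unfolding a_def integral_spec_norm_truncated[symmetric]
    by (rule integral_mono[OF integrable_spec_norm_truncated int])
      (auto simp: indicator_def max_def)
  moreover have incr: "a n - a m = (norm (A (E (real n) x) - A (E (real m) x)))\<^sup>2" if "m \<le> n" for m n
    using norm_A_E_increment[of "real m" "real n" x] that by (simp add: a_def diff E_dom)
  have "incseq a"
  proof (rule incseq_SucI)
    show "a n \<le> a (Suc n)" for n
      using incr[of n "Suc n"] zero_le_power2[of "norm (A (E (real (Suc n)) x) - A (E (real n) x))"]
      by linarith
  qed
  ultimately obtain l where "a \<longlonglongrightarrow> l"
    using incseq_convergent[of a] by blast
  then have "Cauchy a" by (rule LIMSEQ_imp_Cauchy)
  then have "Cauchy (\<lambda>n. A (E (real n) x))"
    by (rule Cauchy_if_norm_square_le) (simp add: incr)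
  then obtain z where "(\<lambda>n. A (E (real n) x)) \<longlonglongrightarrow> z"
    using Cauchy_convergent convergent_def by blast
  then show ?thesis
    using closed_graph[of "\<lambda>n. E (real n) x" x z] E_dom E_real_tendsto by blast
qed

end

subsection \<open>Real and complex scalars\<close>

lemma rc_cnj_of_real: "rc_cnj (of_real r :: 'k::rc_field) = of_real r"
proof (cases "r = 0")
  case True
  have "rc_cnj (0 + 0 :: 'k) = rc_cnj 0 + rc_cnj 0" by (rule rc_cnj_add)
  then show ?thesis using True by simp
next
  case False
  have "(of_real r :: 'k) * rc_cnj (of_real r) = of_real r * of_real r"
    by (simp add: mult_rc_cnj scaleR_conv_of_real power2_eq_square)
  then show ?thesis using False by simp
qed

lemma rc_Re_of_real: "rc_Re (of_real r :: 'k::rc_field) = r"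
proof -
  have "(2 * rc_Re (of_real r :: 'k)) *\<^sub>R (1 :: 'k) = (2 * r) *\<^sub>R 1"
    unfolding add_rc_cnj[symmetric] rc_cnj_of_real
    by (simp add: scaleR_conv_of_real)
  then show ?thesis by simp
qed

context rc_hilbert_space
begin

lemma ip_zero_left: "ip 0 y = 0"
  using ip_add_left[of 0 0 y] by simp

lemma ip_minus_left: "ip (- x) y = - ip x y"
  using ip_add_left[of x "- x" y] ip_zero_left[of y] by (simp add: add_eq_0_iff)

lemma ip_diff_left: "ip (x - y) z = ip x z - ip y z"
  using ip_add_left[of x "- y" z] ip_minus_left[of y z] by simp

lemma ip_add_right: "ip z (x + y) = ip z x + ip z y"
  by (metis ip_add_left ip_commute rc_cnj_add)

lemma ip_diff_right: "ip z (x - y) = ip z x - ip z y"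
  using ip_add_right[of z "x - y" y] by simp

text \<open>Polarization: expand \<open>ip (x + y) (x + y)\<close> and compare norms.\<close>

lemma rc_Re_ip: "rc_Re (ip x y) = inner x y"
proof -
  have "ip (x + y) (x + y) = ip x x + (ip x y + rc_cnj (ip x y)) + ip y y"
    by (simp add: ip_add_left ip_add_right ip_commute[of y x] algebra_simps)
  then have "(of_real ((norm (x + y))\<^sup>2) :: 'k)
      = of_real ((norm x)\<^sup>2) + of_real (2 * rc_Re (ip x y)) + of_real ((norm y)\<^sup>2)"
    by (simp only: ip_self add_rc_cnj) (simp add: scaleR_conv_of_real)
  then have "(norm (x + y))\<^sup>2 = (norm x)\<^sup>2 + 2 * rc_Re (ip x y) + (norm y)\<^sup>2"
    by (simp only: of_real_add[symmetric] of_real_eq_iff)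
  then show ?thesis
    by (simp add: power2_norm_eq_inner inner_add_left inner_add_right inner_commute)
qed

text \<open>If \<open>c = f x\<close>, then \<open>f (smul (rc_cnj c) x) = |c|\<^sup>2\<close> is real.\<close>

lemma functional_zero_if_rc_Re_zero:
  assumes M: "subspace M" and f: "\<And>c x. x \<in> M \<Longrightarrow> f (smul c x) = c * f x"
    and Re: "\<And>x. x \<in> M \<Longrightarrow> rc_Re (f x) = 0" and x: "x \<in> M"
  shows "f x = (0 :: 'k)"
proof -
  have "f (smul (rc_cnj (f x)) x) = of_real ((norm (f x))\<^sup>2)"
    using f[OF x] mult_rc_cnj[of "f x"] by (simp add: mult.commute scaleR_conv_of_real)
  moreover have "smul (rc_cnj (f x)) x \<in> M" using M x by (rule subspace_scale)
  ultimately have "(norm (f x))\<^sup>2 = 0" using Re rc_Re_of_real by metis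
  then show ?thesis by simp
qed

lemma real_subspace: "subspace M \<Longrightarrow> real_vector.subspace M"
  unfolding real_vector.subspace_def subspace_def by (metis smul_of_real)

text \<open>For fixed \<open>w\<close> the functional \<open>ip z w\<close> is homogeneous in
  \<open>z\<close>, so on a subspace over the scalar field it vanishes as soon as its real part
  does.\<close>

lemma ip_orthogonal_iff_inner:
  assumes M: "subspace M"
  shows "(\<forall>z\<in>M. ip w z = 0) \<longleftrightarrow> (\<forall>z\<in>M. inner w z = 0)"
proof
  assume "\<forall>z\<in>M. ip w z = 0"
  then show "\<forall>z\<in>M. inner w z = 0"
    using rc_Re_ip rc_Re_of_real[of 0] by (metis of_real_0)
next
  assume *: "\<forall>z\<in>M. inner w z = 0"
  have "ip z w = 0" if "z \<in> M" for z
    by (rule functional_zero_if_rc_Re_zero[OF M, of "\<lambda>z. ip z w"])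
      (use * that in \<open>auto simp: ip_smul_left rc_Re_ip inner_commute\<close>)
  then show "\<forall>z\<in>M. ip w z = 0"
    using ip_commute rc_cnj_of_real[of 0] by (metis of_real_0)
qed

lemma orth_proj_eq_proj: "subspace M \<Longrightarrow> orth_proj ip M = proj M"
  by (rule ext) (simp add: orth_proj_def proj_def ip_orthogonal_iff_inner)

text \<open>The same argument for the functional \<open>ip (A x) y - ip x z\<close> of
  \<open>x\<close>. Hence the adjoint is the same for \<open>ip\<close> and for
  \<open>inner\<close>.\<close>

lemma adjoint_iff_inner:
  assumes "linear_operator_on smul D A"
  shows "(\<forall>x\<in>D. ip (A x) y = ip x z) \<longleftrightarrow> (\<forall>x\<in>D. inner (A x) y = inner x z)"
proof
  assume "\<forall>x\<in>D. ip (A x) y = ip x z"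
  then show "\<forall>x\<in>D. inner (A x) y = inner x z" by (metis rc_Re_ip)
next
  assume *: "\<forall>x\<in>D. inner (A x) y = inner x z"
  have D: "subspace D" and smul: "\<And>c x. x \<in> D \<Longrightarrow> A (smul c x) = smul c (A x)"
    using assms by (auto simp: linear_operator_on_def)
  have Re_diff: "rc_Re (u - v) = rc_Re u - rc_Re (v :: 'k)" for u v
  proof -
    have "(2 * rc_Re ((u - v) + v)) *\<^sub>R (1 :: 'k) = (2 * rc_Re (u - v) + 2 * rc_Re v) *\<^sub>R 1"
      unfolding scaleR_add_left add_rc_cnj[symmetric] rc_cnj_add by simp
    then show ?thesis by simp
  qed
  have "ip (A x) y - ip x z = 0" if "x \<in> D" for x
    by (rule functional_zero_if_rc_Re_zero[OF D, of "\<lambda>x. ip (A x) y - ip x z"])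
      (use * that in \<open>auto simp: smul ip_smul_left Re_diff rc_Re_ip right_diff_distrib\<close>)
  then show "\<forall>x\<in>D. ip (A x) y = ip x z" by simp
qed

lemma norm_smul: "norm (smul c x) = norm c * norm x"
proof -
  have "(of_real ((norm (smul c x))\<^sup>2) :: 'k) = c * rc_cnj (c * ip x x)"
    using ip_self[of "smul c x"] ip_smul_left ip_commute by metis
  also have "\<dots> = of_real ((norm c * norm x)\<^sup>2)"
    unfolding rc_cnj_mult ip_self rc_cnj_of_real mult.assoc[symmetric] mult_rc_cnj
    by (simp add: scaleR_conv_of_real power_mult_distrib)
  finally have "(norm (smul c x))\<^sup>2 = (norm c * norm x)\<^sup>2" by (simp only: of_real_eq_iff)
  then show ?thesis by (simp add: power2_eq_iff_nonneg)
qed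

end

lemma dense_inner_eqI:
  fixes z z' :: "'a::real_inner"
  assumes "closure D = UNIV" "\<And>x. x \<in> D \<Longrightarrow> inner x z = inner x z'"
  shows "z = z'"
proof -
  have "closed {x. inner x z = inner x z'}"
    by (intro closed_Collect_eq continuous_intros)
  then have "closure D \<subseteq> {x. inner x z = inner x z'}"
    using assms(2) by (intro closure_minimal) auto
  then have "inner (z - z') (z - z') = 0"
    using assms(1) by (auto simp: inner_diff_right)
  then show ?thesis by simp
qed

lemma nonneg_self_adjointI:
  fixes smul :: "'k::rc_field \<Rightarrow> 'a::{real_inner,complete_space} \<Rightarrow> 'a"
  assumes "rc_hilbert_space smul ip" and "self_adjoint smul ip D A" and "nonneg_operator ip D A"
  shows "nonneg_self_adjoint D A"
proof -
  interpret rc_hilbert_space smul ip by fact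
  have lin: "linear_operator_on smul D A" and dense: "closure D = UNIV"
    and dom: "adjoint_dom ip D A = D" and op: "\<And>x. x \<in> D \<Longrightarrow> adjoint_op ip D A x = A x"
    using assms(2) by (auto simp: self_adjoint_def)
  have D: "subspace D" using lin by (simp add: linear_operator_on_def)
  have dom_iff: "y \<in> D \<longleftrightarrow> (\<exists>z. \<forall>x\<in>D. inner (A x) y = inner x z)" for y
    unfolding adjoint_iff_inner[OF lin, symmetric] using dom by (auto simp: adjoint_dom_def)
  have unique: "z = z'"
    if "\<forall>x\<in>D. inner (A x) y = inner x z" "\<forall>x\<in>D. inner (A x) y = inner x z'" for y z z'
    using that by (intro dense_inner_eqI[OF dense]) simp
  have A_eq: "A y = z" if "\<forall>x\<in>D. inner (A x) y = inner x z" for y z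
  proof -
    have "y \<in> D" using that dom_iff by blast
    \<comment> \<open>Density of \<open>D\<close> makes \<open>z\<close> unique, so the definite
      description in \<open>adjoint_op\<close> picks it.\<close>
    have "adjoint_op ip D A y = z"
      unfolding adjoint_op_def adjoint_iff_inner[OF lin]
      using that unique by (intro the_equality) blast+
    then show ?thesis using op[OF \<open>y \<in> D\<close>] by simp
  qed
  show ?thesis
  proof
    show "real_vector.subspace D" by (rule real_subspace[OF D])
    fix x y z r
    show "A (x + y) = A x + A y" if "x \<in> D" "y \<in> D"
      using lin that by (simp add: linear_operator_on_def)
    show "A (r *\<^sub>R x) = r *\<^sub>R A x" if "x \<in> D"
      using lin that unfolding linear_operator_on_def smul_of_real[symmetric] by blast
    show "(\<forall>x\<in>D. inner (A x) y = inner x z) \<longleftrightarrow> y \<in> D \<and> A y = z"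
      using dom_iff[of y] A_eq[of y] by metis
    show "0 \<le> inner (A x) x" if "x \<in> D"
    proof -
      have "ip (A x) x \<in> \<real>\<^sub>\<ge>\<^sub>0" using assms(3) that by (simp add: nonneg_operator_def)
      then obtain r where "ip (A x) x = of_real r" "0 \<le> r" by (rule nonneg_Reals_cases)
      then show ?thesis using rc_Re_ip[of "A x" x] by (simp add: rc_Re_of_real)
    qed
  qed (rule dense)
qed

theorem mainTheorem2:
  fixes smul :: "'k::rc_field \<Rightarrow> 'a::{real_inner,complete_space} \<Rightarrow> 'a"
    and ip :: "'a \<Rightarrow> 'a \<Rightarrow> 'k"
    and D :: "'a set"
    and A :: "'a \<Rightarrow> 'a"
    and E :: "real \<Rightarrow> 'a \<Rightarrow> 'a"
  assumes "rc_hilbert_space smul ip"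
    and "self_adjoint smul ip D A"
    and "nonneg_operator ip D A"
    and "\<And>t. E t = orth_proj ip (F_space D A t)"
  shows "(\<forall>t. closed_subspace smul (F_space D A t)) \<and>
         spectral_family smul ip E \<and>
         has_spectral_integral ip D A E"
proof -
  interpret rc_hilbert_space smul ip by fact
  interpret sa: nonneg_self_adjoint D A by (rule nonneg_self_adjointI[OF assms(1-3)])
  have lin: "linear_operator_on smul D A" using assms(2) by (simp add: self_adjoint_def)
  have D: "subspace D" and smul: "\<And>c x. x \<in> D \<Longrightarrow> A (smul c x) = smul c (A x)"
    using lin by (auto simp: linear_operator_on_def)
  \<comment> \<open>\<open>sa.subspace_F\<close> speaks of real scalars only; homogeneity of
    \<open>A\<close> and \<open>norm_smul\<close> supply the others.\<close>
  have "smul c x \<in> F_space D A t" if "x \<in> F_space D A t" for c x t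
  proof -
    have x: "(A ^^ n) x \<in> D" "norm ((A ^^ n) x) \<le> t ^ n * norm x" for n
      using that unfolding sa.F_iff by auto
    have "(A ^^ n) (smul c x) = smul c ((A ^^ n) x)" for n
      using x by (induction n) (auto simp: smul)
    then show ?thesis
      unfolding sa.F_iff using x subspace_scale[OF D] mult_left_mono[OF x(2), of "norm c"]
      by (simp add: norm_smul mult.left_commute)
  qed
  then have subspace_F: "subspace (F_space D A t)" for t
    using sa.subspace_F[of t] unfolding real_vector.subspace_def subspace_def by blast
  then have closed_F: "closed_subspace smul (F_space D A t)" for t
    by (simp add: closed_subspace_def sa.closed_F)
  have E: "E t = sa.E t" for t
    unfolding assms(4) by (rule orth_proj_eq_proj[OF subspace_F])
  \<comment> \<open>This gives the monotonicity of \<open>E\<close> and identifies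
    \<open>spectral_measure ip E x\<close> with \<open>sa.spec x\<close>.\<close>
  have ip_E: "ip (E t x) x = of_real ((norm (sa.E t x))\<^sup>2)" for t x
  proof -
    have "\<forall>z\<in>F_space D A t. ip (x - sa.E t x) z = 0"
      unfolding ip_orthogonal_iff_inner[OF subspace_F] using sa.E_orth by blast
    then have "ip (x - sa.E t x) (sa.E t x) = 0" using sa.E_in by blast
    then have "ip (sa.E t x) (x - sa.E t x) = 0"
      using ip_commute rc_cnj_of_real[of 0] by (metis of_real_0)
    then show ?thesis by (simp add: E ip_diff_right ip_self)
  qed
  have mono: "nonneg_operator ip UNIV (\<lambda>x. E s x - E t x)" if "t \<le> s" for s t
    unfolding nonneg_operator_def
    using sa.norm_E_mono[OF that]
    by (simp add: ip_diff_left ip_E of_real_diff[symmetric] del: of_real_diff of_real_power)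
  have "spectral_family smul ip E"
    unfolding spectral_family_def
  proof (intro conjI allI impI mono)
    show "is_orth_proj smul ip (E t)" for t
      using closed_F assms(4) unfolding is_orth_proj_def by blast
    show "continuous (at_right t) (\<lambda>s. E s x)" for x t
      unfolding continuous_within E by (rule sa.E_right_limit)
    show "((\<lambda>t. E t x) \<longlongrightarrow> 0) at_bot" for x
      unfolding E by (rule sa.E_at_bot)
    show "((\<lambda>t. E t x) \<longlongrightarrow> x) at_top" for x
      unfolding E by (rule sa.E_at_top)
  qed
  moreover have "has_spectral_integral ip D A E"
  proof -
    have spec: "spectral_measure ip E x = sa.spec x" for x
      by (simp add: spectral_measure_def ip_E rc_Re_of_real del: of_real_power)
    \<comment> \<open>Nonnegativity makes \<open>ip (A x) x\<close> real, hence equal to its real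
      part \<open>inner (A x) x\<close>.\<close>
    have form: "ip (A x) x = of_real (inner (A x) x)" if "x \<in> D" for x
    proof -
      have "ip (A x) x \<in> \<real>\<^sub>\<ge>\<^sub>0" using assms(3) that by (simp add: nonneg_operator_def)
      then obtain r where "ip (A x) x = of_real r" by (rule nonneg_Reals_cases)
      then show ?thesis using rc_Re_ip[of "A x" x] by (simp add: rc_Re_of_real)
    qed
    have "D = {x. (\<integral>\<^sup>+ t. ennreal (t\<^sup>2) \<partial>sa.spec x) < \<infinity>}"
      using sa.nn_integral_spec_norm sa.in_dom_if_nn_integral_finite by auto
    then show ?thesis
      unfolding has_spectral_integral_def spec
      using sa.integrable_spec_form sa.integral_spec_form sa.nn_integral_spec_norm form by simp
  qed
  ultimately show ?thesis using closed_F by blast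
qed

end
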